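(* For every $\varepsilon>0$ and every $k\in\mathbb{N}$ there exists $n\in\mathbb{N}$ such that the set $\{\mu\in\mathfrak{O}:|\mu|^2=n\}$ has more than $k$ elements, and every such $\mu$ lies on one of the six arcs $\{\sqrt n\,e^{i(\nu\pi/3+\varphi)}: |\varphi|<\varepsilon\}$, $\nu=0,1,\dots,5$.
   Context: $\omega=e^{i\pi/3}$ and $\mathfrak{O}=\mathbb{Z}[\omega]\subset\mathbb{C}$ (the hexagonal lattice). *)

theory Defs
  imports "HOL-Analysis.Analysis"
begin

definition omega :: complex where
  "omega = exp (\<i> * of_real (pi / 3))"

definition eisenstein :: "complex set" where
  "eisenstein = {of_int a + of_int b * omega | a b :: int. True}"

end

theory Submission
  imports Defs "HOL-Computational_Algebra.Euclidean_Algorithm"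
begin

text \<open>
  If \<open>\<pi>\<close> is a prime of the Eisenstein integers that is not associated to its conjugate, the
  elements of norm \<open>N(\<pi>)\<^sup>2\<^sup>k\<close> are the products of a unit with \<open>\<pi>\<^sup>i \<pi>'\<^sup>j\<close>, \<open>i + j = 2k\<close>, where \<open>\<pi>'\<close>
  is the conjugate of \<open>\<pi>\<close>. If the argument of \<open>\<pi>\<close> is close to a multiple of \<open>pi / 6\<close>, all of them
  lie near the six directions. So it suffices to find such primes with \<open>sgn(\<pi>)\<^sup>1\<^sup>2\<close> arbitrarily close to 1.

  For this, compare the sums \<open>S\<^sub>k(s) = \<Sum> Re(sgn(\<pi>)\<^sup>1\<^sup>2\<^sup>k) N(\<pi>)\<^sup>-\<^sup>s\<close> over all primes as \<open>s \<rightarrow> 1\<close>. By the Euler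
  product, \<open>S\<^sub>k\<close> is \<open>ln |L\<^sub>k|\<close> up to a bounded error, where \<open>L\<^sub>k(s)\<close> is the lattice sum of
  \<open>sgn(x)\<^sup>1\<^sup>2\<^sup>k N(x)\<^sup>-\<^sup>s\<close>. Now \<open>L\<^sub>0\<close> is unbounded and \<open>L\<^sub>k\<close> is bounded for \<open>k \<ge> 1\<close>, so \<open>S\<^sub>0\<close> is unbounded while each
  other \<open>S\<^sub>k\<close> is bounded above. These one-sided bounds already prevent the
  points \<open>sgn(\<pi>)\<^sup>1\<^sup>2\<close> from avoiding a neighbourhood of 1, so no nonvanishing theorem for
  the \<open>L\<^sub>k\<close> is needed.
\<close>

subsection \<open>The ring of Eisenstein integers\<close>

lemma omega_eq: "omega = Complex (1/2) (sqrt 3 / 2)"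
  unfolding omega_def cis_conv_exp [symmetric] by (simp add: complex_eq_iff cos_60 sin_60)

lemma omega_square: "omega * omega = omega - 1"
  by (simp add: omega_eq complex_eq_iff)

lemma cnj_omega: "cnj omega = 1 - omega"
  by (simp add: omega_eq complex_eq_iff)

lemma cmod_add_mult_omega: "(cmod (of_real x + of_real y * omega))\<^sup>2 = x\<^sup>2 + x * y + y\<^sup>2"
proof -
  have "(cmod (of_real x + of_real y * omega))\<^sup>2 = (x + y / 2)\<^sup>2 + (y * sqrt 3 / 2)\<^sup>2"
    by (simp add: omega_eq cmod_power2)
  also have "\<dots> = x\<^sup>2 + x * y + y\<^sup>2"
    by (simp add: power2_eq_square algebra_simps)
  finally show ?thesis .
qed

lemma eisensteinI: "z = of_int a + of_int b * omega \<Longrightarrow> z \<in> eisenstein"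
  unfolding eisenstein_def by blast

lemma eisensteinE:
  assumes "z \<in> eisenstein"
  obtains a b :: int where "z = of_int a + of_int b * omega"
  using assms unfolding eisenstein_def by blast

lemma of_int_in_eisenstein: "of_int a \<in> eisenstein"
  by (rule eisensteinI [of _ a 0]) simp

lemma omega_in_eisenstein: "omega \<in> eisenstein"
  by (rule eisensteinI [of _ 0 1]) simp

lemma eisenstein_add: "x \<in> eisenstein \<Longrightarrow> y \<in> eisenstein \<Longrightarrow> x + y \<in> eisenstein"
  by (elim eisensteinE, rule_tac a = "a + aa" and b = "b + ba" in eisensteinI)
     (simp add: algebra_simps)

lemma eisenstein_uminus: "x \<in> eisenstein \<Longrightarrow> - x \<in> eisenstein"
  by (elim eisensteinE, rule_tac a = "- a" and b = "- b" in eisensteinI)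
     (simp add: algebra_simps)

lemma eisenstein_diff: "x \<in> eisenstein \<Longrightarrow> y \<in> eisenstein \<Longrightarrow> x - y \<in> eisenstein"
  using eisenstein_add [of x "- y"] eisenstein_uminus [of y] by simp

lemma eisenstein_mult:
  assumes "x \<in> eisenstein" "y \<in> eisenstein"
  shows "x * y \<in> eisenstein"
proof -
  obtain a b where x: "x = of_int a + of_int b * omega"
    using assms(1) by (rule eisensteinE)
  obtain c d where y: "y = of_int c + of_int d * omega"
    using assms(2) by (rule eisensteinE)
  have "x * y = of_int (a * c) + of_int (a * d + b * c) * omega + of_int (b * d) * (omega * omega)"
    by (simp add: x y algebra_simps)
  also have "\<dots> = of_int (a * c - b * d) + of_int (a * d + b * c + b * d) * omega"
    by (simp add: omega_square algebra_simps)
  finally show ?thesis by (rule eisensteinI)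
qed

lemma eisenstein_cnj:
  assumes "x \<in> eisenstein"
  shows "cnj x \<in> eisenstein"
  using assms
proof (rule eisensteinE)
  fix a b assume "x = of_int a + of_int b * omega"
  hence "cnj x = of_int (a + b) + of_int (- b) * omega"
    by (simp add: cnj_omega algebra_simps)
  thus ?thesis by (rule eisensteinI)
qed

text \<open>Rounding both coordinates in the basis 1, \<open>omega\<close> leaves errors of at most
  1/2, hence a squared distance of at most 3/4; this is what division with remainder rests on. The
  last clause makes exact quotients come out exactly, as the law \<open>a * b div b = a\<close>
  demands.\<close>

lemma eisenstein_round:
  "\<exists>w\<in>eisenstein. cmod (z - w) < 1 \<and> (z \<in> eisenstein \<longrightarrow> w = z)"
proof (cases "z \<in> eisenstein")
  case False
  define y where "y = Im z / (sqrt 3 / 2)"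
  define x where "x = Re z - y / 2"
  have z: "z = of_real x + of_real y * omega"
    by (simp add: omega_eq complex_eq_iff x_def y_def)
  define e where "e = x - of_int (round x)"
  define f where "f = y - of_int (round y)"
  have e: "\<bar>e\<bar> \<le> 1/2" and f: "\<bar>f\<bar> \<le> 1/2"
    unfolding e_def f_def
    using of_int_round_abs_le [of x] of_int_round_abs_le [of y] by (auto simp: abs_minus_commute)
  define w where "w = of_int (round x) + of_int (round y) * omega"
  have "z - w = of_real e + of_real f * omega"
    by (simp add: z w_def e_def f_def algebra_simps)
  hence "(cmod (z - w))\<^sup>2 = e\<^sup>2 + e * f + f\<^sup>2"
    by (simp only: cmod_add_mult_omega)
  also have "\<dots> \<le> (1/2)\<^sup>2 + (1/2) * (1/2) + (1/2)\<^sup>2"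
  proof (intro add_mono)
    show "e\<^sup>2 \<le> (1/2)\<^sup>2" "f\<^sup>2 \<le> (1/2)\<^sup>2"
      using e f by (auto simp flip: abs_le_square_iff)
    have "\<bar>e * f\<bar> \<le> (1/2) * (1/2)"
      unfolding abs_mult by (intro mult_mono e f) auto
    thus "e * f \<le> (1/2) * (1/2)" by linarith
  qed
  also have "\<dots> < 1\<^sup>2" by (simp add: power2_eq_square)
  finally have "cmod (z - w) < 1" by (rule power_less_imp_less_base) simp
  moreover have "w \<in> eisenstein" unfolding w_def by (rule eisensteinI) (rule refl)
  ultimately show ?thesis using False by blast
qed auto

definition eisenstein_near :: "complex \<Rightarrow> complex" where
  "eisenstein_near z = (SOME w. w \<in> eisenstein \<and> cmod (z - w) < 1 \<and> (z \<in> eisenstein \<longrightarrow> w = z))"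

lemma eisenstein_near:
  shows eisenstein_near_in: "eisenstein_near z \<in> eisenstein"
    and cmod_eisenstein_near: "cmod (z - eisenstein_near z) < 1"
    and eisenstein_near_eq: "z \<in> eisenstein \<Longrightarrow> eisenstein_near z = z"
proof -
  have "\<exists>w. w \<in> eisenstein \<and> cmod (z - w) < 1 \<and> (z \<in> eisenstein \<longrightarrow> w = z)"
    using eisenstein_round [of z] by blast
  from someI_ex [OF this]
  show "eisenstein_near z \<in> eisenstein" "cmod (z - eisenstein_near z) < 1"
    "z \<in> eisenstein \<Longrightarrow> eisenstein_near z = z"
    unfolding eisenstein_near_def by blast+
qed

text \<open>As a type, the ring can be put into the Euclidean type classes, which supply
  \<open>prime\<close>, \<open>multiplicity\<close> and the theory of factorisation.\<close>

typedef eis = eisenstein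
  morphisms of_eis Abs_eis
  using of_int_in_eisenstein by blast

setup_lifting type_definition_eis

instantiation eis :: idom
begin

lift_definition zero_eis :: eis is 0
  using of_int_in_eisenstein [of 0] by simp

lift_definition one_eis :: eis is 1
  using of_int_in_eisenstein [of 1] by simp

lift_definition plus_eis :: "eis \<Rightarrow> eis \<Rightarrow> eis" is "(+)"
  by (rule eisenstein_add)

lift_definition minus_eis :: "eis \<Rightarrow> eis \<Rightarrow> eis" is "(-)"
  by (rule eisenstein_diff)

lift_definition uminus_eis :: "eis \<Rightarrow> eis" is uminus
  by (rule eisenstein_uminus)

lift_definition times_eis :: "eis \<Rightarrow> eis \<Rightarrow> eis" is "(*)"
  by (rule eisenstein_mult)

instance
  by standard
    (simp_all add: zero_eis.rep_eq one_eis.rep_eq plus_eis.rep_eq minus_eis.rep_eq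
       uminus_eis.rep_eq times_eis.rep_eq algebra_simps flip: of_eis_inject)

end

lift_definition omega_eis :: eis is omega
  by (rule omega_in_eisenstein)

lift_definition cnj_eis :: "eis \<Rightarrow> eis" is cnj
  by (rule eisenstein_cnj)

lemmas of_eis_simps [simp] =
  zero_eis.rep_eq one_eis.rep_eq plus_eis.rep_eq minus_eis.rep_eq uminus_eis.rep_eq
  times_eis.rep_eq omega_eis.rep_eq cnj_eis.rep_eq

lemma of_eis_power [simp]: "of_eis (x ^ n) = of_eis x ^ n"
  by (induction n) auto

lemma of_eis_of_nat [simp]: "of_eis (of_nat n) = of_nat n"
  by (induction n) auto

lemma of_eis_of_int [simp]: "of_eis (of_int n) = of_int n"
  by (cases n) auto

lemma of_eis_eq_iff [simp]: "of_eis x = of_eis y \<longleftrightarrow> x = y"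
  by (rule of_eis_inject)

lemma of_eis_eq_0_iff [simp]: "of_eis x = 0 \<longleftrightarrow> x = 0"
  using of_eis_eq_iff [of x 0] by simp

lemma cnj_eis_simps [simp]:
  "cnj_eis (x + y) = cnj_eis x + cnj_eis y"
  "cnj_eis (x * y) = cnj_eis x * cnj_eis y"
  "cnj_eis (cnj_eis x) = x"
  "cnj_eis 1 = 1"
  "cnj_eis (x ^ n) = cnj_eis x ^ n"
  "cnj_eis (of_int k) = of_int k"
  by (simp_all flip: of_eis_eq_iff)

lemma cnj_eis_eq_0_iff [simp]: "cnj_eis x = 0 \<longleftrightarrow> x = 0"
  using of_eis_eq_0_iff [of "cnj_eis x"] by simp

lemma omega_eis_square: "omega_eis * omega_eis = omega_eis - 1"
  by (simp add: omega_square flip: of_eis_eq_iff)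

definition eis_of :: "int \<times> int \<Rightarrow> eis" where
  "eis_of = (\<lambda>(a, b). of_int a + of_int b * omega_eis)"

lemma of_eis_eis_of: "of_eis (eis_of (a, b)) = of_int a + of_int b * omega"
  by (simp add: eis_of_def)

lemma bij_eis_of: "bij eis_of"
proof (rule bijI)
  show "inj eis_of"
  proof (rule injI)
    fix p q assume eq: "eis_of p = eis_of q"
    obtain a b c d where p: "p = (a, b)" "q = (c, d)" by (cases p; cases q)
    have "of_eis (eis_of (a, b)) = of_eis (eis_of (c, d))" using eq p by simp
    hence "Im (of_int a + of_int b * omega) = Im (of_int c + of_int d * omega)"
          "Re (of_int a + of_int b * omega) = Re (of_int c + of_int d * omega)"
      by (simp_all only: of_eis_eis_of)
    thus "p = q" by (simp add: omega_eq p)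
  qed
  show "surj eis_of"
  proof (rule surjI)
    fix x
    show "eis_of (SOME p. eis_of p = x) = x"
    proof (rule someI_ex)
      have "of_eis x \<in> eisenstein" by (rule of_eis)
      then obtain a b where "of_eis x = of_int a + of_int b * omega" by (rule eisensteinE)
      hence "eis_of (a, b) = x" by (simp add: of_eis_eis_of flip: of_eis_eq_iff)
      thus "\<exists>p. eis_of p = x" ..
    qed
  qed
qed

lemma eis_of_cases:
  obtains a b where "x = eis_of (a, b)"
proof -
  obtain p where "x = eis_of p" using bij_eis_of by (metis bij_pointE)
  thus ?thesis using that by (cases p) auto
qed

text \<open>On the lattice the squared modulus is an integer, so the floor loses nothing; natural
  values let it serve as the Euclidean size.\<close>

definition eis_norm :: "eis \<Rightarrow> nat" where
  "eis_norm x = nat \<lfloor>(cmod (of_eis x))\<^sup>2\<rfloor>"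

lemma cmod_eis_of: "(cmod (of_eis (eis_of (a, b))))\<^sup>2 = of_int (a\<^sup>2 + a * b + b\<^sup>2)"
  using cmod_add_mult_omega [of "of_int a" "of_int b"] by (simp add: of_eis_eis_of)

lemma of_nat_eis_norm: "real (eis_norm x) = (cmod (of_eis x))\<^sup>2"
proof (cases x rule: eis_of_cases)
  case (1 a b)
  have "of_int (a\<^sup>2 + a * b + b\<^sup>2) \<ge> (0::real)"
    unfolding cmod_eis_of [symmetric] by simp
  thus ?thesis unfolding 1 eis_norm_def cmod_eis_of
    by (simp only: floor_of_int)
qed

lemma eis_norm_mult: "eis_norm (x * y) = eis_norm x * eis_norm y"
proof -
  have "real (eis_norm (x * y)) = real (eis_norm x * eis_norm y)"
    by (simp add: of_nat_eis_norm norm_mult power_mult_distrib)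
  thus ?thesis by (simp only: of_nat_eq_iff)
qed

lemma eis_norm_eq_0_iff [simp]: "eis_norm x = 0 \<longleftrightarrow> x = 0"
  using of_nat_eis_norm [of x] by auto

lemma eis_norm_1 [simp]: "eis_norm 1 = 1"
  by (simp add: eis_norm_def)

lemma eis_norm_power: "eis_norm (x ^ n) = eis_norm x ^ n"
  by (induction n) (simp_all add: eis_norm_mult)

lemma cmod_of_eis_ge_1: "x \<noteq> 0 \<Longrightarrow> cmod (of_eis x) \<ge> 1"
proof -
  assume "x \<noteq> 0"
  hence "eis_norm x \<ge> 1" by (metis eis_norm_eq_0_iff less_one not_le)
  hence "1\<^sup>2 \<le> (cmod (of_eis x))\<^sup>2" by (simp flip: of_nat_eis_norm)
  thus ?thesis by (rule power2_le_imp_le) simp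
qed

lemma mult_cnj_eis: "x * cnj_eis x = of_nat (eis_norm x)"
proof -
  have "of_nat (eis_norm x) = complex_of_real ((cmod (of_eis x))\<^sup>2)"
    by (metis of_nat_eis_norm of_real_of_nat_eq)
  also have "\<dots> = of_eis x * cnj (of_eis x)" by (rule complex_norm_square)
  finally show ?thesis by (simp flip: of_eis_eq_iff)
qed

lemma eis_norm_1_imp_unit:
  assumes "eis_norm x = 1"
  shows "x dvd 1"
  using mult_cnj_eis [of x] assms by (metis dvdI of_nat_1)

lemma unit_imp_eis_norm_1:
  assumes "x dvd 1"
  shows "eis_norm x = 1"
proof -
  obtain y where "1 = x * y" using assms by (rule dvdE)
  hence "eis_norm x * eis_norm y = 1" by (metis eis_norm_1 eis_norm_mult)
  thus ?thesis by simp
qed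

instantiation eis :: normalization_euclidean_semiring
begin

lift_definition divide_eis :: "eis \<Rightarrow> eis \<Rightarrow> eis" is
  "\<lambda>x y. if y = 0 then 0 else eisenstein_near (x / y)"
  using eisenstein_near_in of_int_in_eisenstein [of 0] by auto

definition modulo_eis :: "eis \<Rightarrow> eis \<Rightarrow> eis" where
  "modulo_eis x y = x - x div y * y"

definition euclidean_size_eis :: "eis \<Rightarrow> nat" where
  "euclidean_size_eis = eis_norm"

text \<open>No canonical representative of an associate class is needed, so one is chosen arbitrarily.\<close>

definition normalize_eis :: "eis \<Rightarrow> eis" where
  "normalize_eis x = (if x dvd 1 then 1 else SOME y. x dvd y \<and> y dvd x)"

definition unit_factor_eis :: "eis \<Rightarrow> eis" where
  "unit_factor_eis x = (if x = 0 then 0 else x div normalize x)"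

instance
proof
  fix a b :: eis
  show cancel: "a * b div b = a" if "b \<noteq> 0" for a b :: eis
    using that by transfer (auto simp: eisenstein_near_eq)
  show "a div 0 = 0" by transfer simp
  show "a div b * b + a mod b = a" by (simp add: modulo_eis_def)
  show "euclidean_size (0::eis) = 0" by (simp add: euclidean_size_eis_def)
  show "euclidean_size (a mod b) < euclidean_size b" if "b \<noteq> 0"
  proof -
    \<comment> \<open>The remainder is \<open>b\<close> times the rounding error of the quotient,
      whose modulus is below 1.\<close>
    have "of_eis (a mod b) = of_eis b * (of_eis a / of_eis b - eisenstein_near (of_eis a / of_eis b))"
      using that by (simp add: modulo_eis_def divide_eis.rep_eq right_diff_distrib)
    hence "(cmod (of_eis (a mod b)))\<^sup>2 < (cmod (of_eis b))\<^sup>2"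
      using cmod_eisenstein_near [of "of_eis a / of_eis b"] that
      by (intro power_strict_mono) (auto simp: norm_mult)
    hence "real (eis_norm (a mod b)) < real (eis_norm b)" by (simp add: of_nat_eis_norm)
    thus ?thesis by (simp add: euclidean_size_eis_def)
  qed
  show "euclidean_size a \<le> euclidean_size (a * b)" if "b \<noteq> 0"
    using that eis_norm_eq_0_iff [of b]
    by (simp add: euclidean_size_eis_def eis_norm_mult Suc_le_eq del: eis_norm_eq_0_iff)
  show "unit_factor (0::eis) = 0" by (simp add: unit_factor_eis_def)
  have assoc: "x dvd normalize x \<and> normalize x dvd x" for x :: eis
  proof (cases "x dvd 1")
    case False
    have "\<exists>y. x dvd y \<and> y dvd x" by (rule exI [of _ x]) simp
    from someI_ex [OF this] show ?thesis using False by (simp add: normalize_eis_def)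
  qed (simp add: normalize_eis_def)
  show norm0: "normalize (0::eis) = 0" using assoc [of 0] by simp
  have nz: "normalize x \<noteq> 0" if "x \<noteq> 0" for x :: eis using assoc [of x] that by auto
  have dvd_div: "x div y * y = x" if "y dvd x" "y \<noteq> 0" for x y :: eis
  proof -
    obtain t where "x = y * t" using \<open>y dvd x\<close> by (rule dvdE)
    thus ?thesis using cancel [OF \<open>y \<noteq> 0\<close>, of t] by (simp add: mult.commute)
  qed
  show uf: "unit_factor a * normalize a = a" for a :: eis
  proof (cases "a = 0")
    case False
    thus ?thesis using dvd_div [of "normalize a" a] assoc [of a] nz [of a]
      by (simp add: unit_factor_eis_def)
  qed (simp add: norm0)
  show "unit_factor a = a" if "a dvd 1"
    using that cancel [of 1 a] by (simp add: unit_factor_eis_def normalize_eis_def)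
  show ufu: "unit_factor a dvd 1" if "a \<noteq> 0" for a :: eis
  proof -
    obtain c where c: "normalize a = a * c" using assoc [of a] by (auto elim: dvdE)
    have "(unit_factor a * c) * a = 1 * a" using uf [of a] c by (simp add: algebra_simps)
    hence "unit_factor a * c = 1" using that by simp
    thus ?thesis by (intro dvdI [of _ _ c]) simp
  qed
  show "unit_factor (a * b) = a * unit_factor b" if "a dvd 1"
  proof (cases "b = 0")
    case False
    obtain c where c: "1 = a * c" using \<open>a dvd 1\<close> by (rule dvdE)
    \<comment> \<open>A unit factor changes divisibility on neither side, so \<open>a * b\<close>
      and \<open>b\<close> have the same associates and therefore the same chosen
      representative.\<close>
    have d1: "a * x dvd y \<longleftrightarrow> x dvd y" for x y
    proof
      assume "x dvd y"
      then obtain t where "y = x * t" by (rule dvdE)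
      hence "y = (a * c) * x * t" using c by simp
      hence "y = (a * x) * (c * t)" by (simp only: mult_ac)
      thus "a * x dvd y" by (rule dvdI)
    qed (rule dvd_mult_right)
    have d2: "x dvd a * y \<longleftrightarrow> x dvd y" for x y
    proof
      assume "x dvd a * y"
      hence "x dvd c * (a * y)" by (rule dvd_mult)
      also have "c * (a * y) = a * c * y" by (simp only: mult_ac)
      finally show "x dvd y" using c by simp
    qed simp
    have "normalize (a * b) = normalize b"
      unfolding normalize_eis_def d1 d2 by simp
    moreover have "a \<noteq> 0" using c by auto
    ultimately have "unit_factor (a * b) * normalize b = (a * unit_factor b) * normalize b"
      using uf [of "a * b"] uf [of b] by (simp add: mult.assoc)
    thus ?thesis using nz [OF False] by simp
  qed (simp add: unit_factor_eis_def)
qed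

end

section \<open>The six units\<close>

lemma is_unit_eis_iff: "x dvd 1 \<longleftrightarrow> eis_norm x = 1"
  using eis_norm_1_imp_unit unit_imp_eis_norm_1 by blast

text \<open>Four times the form is \<open>(2 * a + b)\<^sup>2 + 3 * b\<^sup>2\<close>, and
  symmetrically with \<open>a\<close> and \<open>b\<close> exchanged; thus neither coordinate
  exceeds 1 in absolute value.\<close>

lemma int_norm_form_eq_1:
  fixes a b :: int
  assumes "a\<^sup>2 + a * b + b\<^sup>2 = 1"
  shows "(a, b) \<in> {(1,0), (-1,0), (0,1), (0,-1), (-1,1), (1,-1)}"
proof -
  have "(2 * a + b)\<^sup>2 + 3 * b\<^sup>2 = 4" "(2 * b + a)\<^sup>2 + 3 * a\<^sup>2 = 4"
    using assms by (auto simp: power2_eq_square algebra_simps)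
  hence "3 * b\<^sup>2 \<le> 4" "3 * a\<^sup>2 \<le> 4"
    by (metis le_add_same_cancel2 zero_le_power2)+
  hence "b\<^sup>2 < 2\<^sup>2" "a\<^sup>2 < 2\<^sup>2" by auto
  hence "\<bar>b\<bar> < 2" "\<bar>a\<bar> < 2" by (metis abs_numeral power2_less_imp_less abs_ge_zero power2_abs)+
  hence "a \<in> {-1, 0, 1}" "b \<in> {-1, 0, 1}" by auto
  thus ?thesis using assms by auto
qed

lemma omega_eis_power3: "omega_eis ^ 3 = -1"
proof -
  have "omega_eis ^ 3 = omega_eis * (omega_eis * omega_eis)" by (simp add: power3_eq_cube mult.assoc)
  also have "\<dots> = -1" by (simp add: omega_eis_square right_diff_distrib)
  finally show ?thesis .
qed

text \<open>The six solutions of the norm equation are matched with the powers 0 to 5 of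
  \<open>omega_eis\<close>, reduced by means of its quadratic equation and
  \<open>omega_eis ^ 3 = -1\<close>.\<close>

lemma is_unit_eis_imp_omega_power:
  assumes "x dvd (1::eis)"
  shows "\<exists>i<6. x = omega_eis ^ i"
proof (cases x rule: eis_of_cases)
  case (1 a b)
  have "real_of_int (a\<^sup>2 + a * b + b\<^sup>2) = real (eis_norm x)"
    unfolding of_nat_eis_norm 1 cmod_eis_of ..
  also have "\<dots> = 1" using assms by (simp add: is_unit_eis_iff)
  finally have "real_of_int (a\<^sup>2 + a * b + b\<^sup>2) = 1" .
  hence "a\<^sup>2 + a * b + b\<^sup>2 = 1" by linarith
  hence ab: "(a, b) \<in> {(1,0), (-1,0), (0,1), (0,-1), (-1,1), (1,-1)}"
    by (rule int_norm_form_eq_1)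
  have p2: "omega_eis ^ 2 = omega_eis - 1" by (simp add: power2_eq_square omega_eis_square)
  have p4: "omega_eis ^ 4 = - omega_eis"
    using omega_eis_power3 by (simp add: eval_nat_numeral)
  have p5: "omega_eis ^ 5 = 1 - omega_eis"
    using omega_eis_power3 p2 by (simp add: eval_nat_numeral)
  have "x = omega_eis ^ 0 \<or> x = omega_eis ^ 1 \<or> x = omega_eis ^ 2 \<or> x = omega_eis ^ 3 \<or>
        x = omega_eis ^ 4 \<or> x = omega_eis ^ 5"
    unfolding p2 p4 p5 omega_eis_power3 using ab by (auto simp: 1 eis_of_def)
  hence "\<exists>i\<in>{0, 1, 2, 3, 4, 5}. x = omega_eis ^ i" by blast
  then obtain i where "i \<in> {0, 1, 2, 3, 4, 5}" "x = omega_eis ^ i" ..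
  moreover from this(1) have "i < 6" by auto
  ultimately show ?thesis by blast
qed

section \<open>Auxiliary facts on finite combinations of sums and on chords of the circle\<close>

lemma has_sum_finite_sum:
  fixes f :: "'i \<Rightarrow> 'a \<Rightarrow> 'b :: {topological_comm_monoid_add}"
  assumes "\<And>i. i \<in> I \<Longrightarrow> (f i has_sum S i) A"
  shows "((\<lambda>x. \<Sum>i\<in>I. f i x) has_sum (\<Sum>i\<in>I. S i)) A"
proof (cases "finite I")
  case True
  thus ?thesis using assms
    by (induction I rule: finite_induct) (auto intro!: has_sum_add)
qed auto

text \<open>A chord is at most as long as its arc; the chord of angle \<open>t\<close> has length
  \<open>2 * \<bar>sin (t / 2)\<bar>\<close>.\<close>

lemma norm_cis_minus_1_le: "norm (cis t - 1) \<le> \<bar>t\<bar>"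
proof -
  have "(norm (cis t - 1))\<^sup>2 = 2 - 2 * cos (2 * (t / 2))"
    using sin_cos_squared_add [of t] by (simp add: cmod_power2 power2_diff)
  also have "\<dots> = (2 * \<bar>sin (t / 2)\<bar>)\<^sup>2"
    unfolding cos_double_sin by (simp add: power_mult_distrib)
  finally have "norm (cis t - 1) = 2 * \<bar>sin (t / 2)\<bar>"
    by (rule power2_eq_imp_eq) auto
  also have "\<dots> \<le> \<bar>t\<bar>" using abs_sin_x_le_abs_x [of "t / 2"] by simp
  finally show ?thesis .
qed

subsection \<open>Fejer kernels and accumulation at 1\<close>

text \<open>The left side is \<open>K\<close> times the Fejer kernel. In the inductive step the new
  power is paired with the earlier ones; since \<open>cnj u\<close> inverts \<open>u\<close>, the
  product \<open>u ^ j * cnj (u ^ K)\<close> depends only on \<open>K - j\<close>.\<close>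

lemma norm_sum_powers_square:
  fixes u :: complex
  assumes "norm u = 1"
  shows "(norm (\<Sum>j<K. u ^ j))\<^sup>2 = real K + 2 * (\<Sum>k=1..<K. real (K - k) * Re (u ^ k))"
proof (induction K)
  case (Suc K)
  have inv: "u * cnj u = 1" using assms by (simp add: complex_norm_square [symmetric])
  have pw: "u ^ j * cnj (u ^ K) = cnj (u ^ (K - j))" if "j < K" for j
  proof -
    have "u ^ K = u ^ j * u ^ (K - j)" using that by (simp flip: power_add)
    hence "u ^ j * cnj (u ^ K) = (u * cnj u) ^ j * cnj (u ^ (K - j))"
      by (simp add: power_mult_distrib)
    thus ?thesis by (simp add: inv)
  qed
  have "(\<Sum>j<K. u ^ j) * cnj (u ^ K) = (\<Sum>j<K. cnj (u ^ (K - j)))"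
    unfolding sum_distrib_right by (intro sum.cong refl pw) auto
  also have "\<dots> = (\<Sum>k=1..<Suc K. cnj (u ^ k))"
    by (rule sum.reindex_bij_witness [of _ "\<lambda>k. K - k" "\<lambda>k. K - k"]) auto
  finally have cross: "Re ((\<Sum>j<K. u ^ j) * cnj (u ^ K)) = (\<Sum>k=1..<Suc K. Re (u ^ k))"
    by (simp del: complex_cnj_power)
  have norm_add: "(norm (x + y))\<^sup>2 = (norm x)\<^sup>2 + (norm y)\<^sup>2 + 2 * Re (x * cnj y)" for x y :: complex
    unfolding cmod_power2 by (simp add: power2_eq_square algebra_simps)
  have "(norm (\<Sum>j<Suc K. u ^ j))\<^sup>2 = (norm ((\<Sum>j<K. u ^ j) + u ^ K))\<^sup>2" by simp
  also have "\<dots> = (norm (\<Sum>j<K. u ^ j))\<^sup>2 + (norm (u ^ K))\<^sup>2 + 2 * Re ((\<Sum>j<K. u ^ j) * cnj (u ^ K))"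
    by (rule norm_add)
  also have "norm (u ^ K) = 1" using assms by (simp add: norm_power)
  also have "(norm (\<Sum>j<K. u ^ j))\<^sup>2 + 1\<^sup>2 + 2 * Re ((\<Sum>j<K. u ^ j) * cnj (u ^ K)) =
      real (Suc K) + 2 * ((\<Sum>k=1..<K. real (K - k) * Re (u ^ k)) + (\<Sum>k=1..<Suc K. Re (u ^ k)))"
    unfolding cross Suc.IH by simp
  \<comment> \<open>The index \<open>K\<close> may be added to the range because its weight
    \<open>real (K - K)\<close> is 0.\<close>
  also have "(\<Sum>k=1..<K. real (K - k) * Re (u ^ k)) = (\<Sum>k=1..<Suc K. real (K - k) * Re (u ^ k))"
    by (cases "K = 0") auto
  also have "\<dots> + (\<Sum>k=1..<Suc K. Re (u ^ k)) = (\<Sum>k=1..<Suc K. real (Suc K - k) * Re (u ^ k))"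
    unfolding sum.distrib [symmetric]
    by (intro sum.cong refl) (auto simp: Suc_diff_le algebra_simps)
  finally show ?case .
qed simp

lemma norm_sum_powers_le:
  fixes u :: complex
  assumes "norm u = 1" "\<delta> > 0" "norm (u - 1) \<ge> \<delta>"
  shows "norm (\<Sum>j<K. u ^ j) \<le> 2 / \<delta>"
proof -
  have u: "u \<noteq> 1" using assms by auto
  have "norm (\<Sum>j<K. u ^ j) = norm (u ^ K - 1) / norm (u - 1)"
    using geometric_sum [OF u, of K] by (simp add: norm_divide)
  also have "\<dots> \<le> 2 / \<delta>"
  proof (rule frac_le)
    have "norm (u ^ K - 1) \<le> norm (u ^ K) + norm (1::complex)" by (rule norm_triangle_ineq4)
    thus "norm (u ^ K - 1) \<le> 2" using assms by (simp add: norm_power)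
  qed (use assms in auto)
  finally show ?thesis .
qed

text \<open>
  Averaging the Fejer kernel over the two conjugate shifts multiplies the \<open>k\<close>-th Fourier coefficient by \<open>Re (v ^ k)\<close>.
\<close>
definition fejer :: "nat \<Rightarrow> complex \<Rightarrow> complex \<Rightarrow> real" where
  "fejer K v u = ((norm (\<Sum>j<K. (u * v) ^ j))\<^sup>2 + (norm (\<Sum>j<K. (u * cnj v) ^ j))\<^sup>2) / (2 * real K)"

lemma fejer_nonneg: "fejer K v u \<ge> 0"
  unfolding fejer_def by simp

lemma fejer_eq:
  assumes "norm u = 1" "norm v = 1" "K > 0"
  shows "fejer K v u = 1 + (\<Sum>k=1..<K. 2 * real (K - k) / real K * Re (v ^ k) * Re (u ^ k))"
proof -
  have n: "norm (u * v) = 1" "norm (u * cnj v) = 1" using assms by (simp_all add: norm_mult)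
  have re: "Re ((u * v) ^ k) + Re ((u * cnj v) ^ k) = 2 * Re (v ^ k) * Re (u ^ k)" for k
  proof -
    have *: "(u * cnj v) ^ k = u ^ k * cnj (v ^ k)" by (simp add: power_mult_distrib)
    show ?thesis unfolding * power_mult_distrib [of u v] by (simp del: complex_cnj_power)
  qed
  have "fejer K v u = (2 * real K + 2 * (\<Sum>k=1..<K. real (K - k) * (Re ((u * v) ^ k) + Re ((u * cnj v) ^ k))))
      / (2 * real K)"
    unfolding fejer_def norm_sum_powers_square [OF n(1)] norm_sum_powers_square [OF n(2)]
    by (simp add: distrib_left sum.distrib)
  also have "\<dots> = 1 + (\<Sum>k=1..<K. real (K - k) * (Re ((u * v) ^ k) + Re ((u * cnj v) ^ k))) / real K"
    using assms by (simp add: field_simps)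
  also have "\<dots> = 1 + (\<Sum>k=1..<K. 2 * real (K - k) / real K * Re (v ^ k) * Re (u ^ k))"
    unfolding re sum_divide_distrib by (intro arg_cong2 [of _ _ _ _ "(+)"] sum.cong refl) simp
  finally show ?thesis .
qed

lemma fejer_le:
  assumes "norm u = 1" "norm v = 1" "K > 0"
  shows "fejer K v u \<le> real K"
proof -
  have *: "(norm (\<Sum>j<K. w ^ j))\<^sup>2 \<le> (real K)\<^sup>2" if "norm w = 1" for w :: complex
  proof (rule power_mono)
    have "norm (\<Sum>j<K. w ^ j) \<le> (\<Sum>j<K. 1)"
      by (rule sum_norm_le) (simp add: norm_power that)
    thus "norm (\<Sum>j<K. w ^ j) \<le> real K" by simp
  qed simp
  have "fejer K v u \<le> ((real K)\<^sup>2 + (real K)\<^sup>2) / (2 * real K)"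
    unfolding fejer_def using assms
    by (intro divide_right_mono add_mono *) (simp_all add: norm_mult)
  also have "\<dots> = real K" using assms by (simp add: power2_eq_square)
  finally show ?thesis .
qed

text \<open>Multiplying by \<open>v\<close> or \<open>cnj v\<close> moves \<open>u\<close> by at
  most \<delta>, so both points stay at distance \<delta> from 1, where geometric sums are at most 2
  / \<delta>.\<close>

lemma fejer_le_off_arc:
  assumes "norm u = 1" "norm v = 1" "K > 0" "\<delta> > 0" "norm (u - 1) \<ge> 2 * \<delta>" "norm (v - 1) \<le> \<delta>"
  shows "fejer K v u \<le> 4 / (real K * \<delta>\<^sup>2)"
proof -
  have far: "norm (u * w - 1) \<ge> \<delta>" if w: "norm w = 1" "norm (w - 1) \<le> \<delta>" for w
  proof -
    have "norm (u - 1) = norm ((u * w - 1) - u * (w - 1))" by (simp add: algebra_simps)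
    also have "\<dots> \<le> norm (u * w - 1) + norm (u * (w - 1))" by (rule norm_triangle_ineq4)
    also have "\<dots> \<le> norm (u * w - 1) + \<delta>" using w assms by (simp add: norm_mult)
    finally show ?thesis using assms by simp
  qed
  have *: "(norm (\<Sum>j<K. (u * w) ^ j))\<^sup>2 \<le> (2 / \<delta>)\<^sup>2" if w: "norm w = 1" "norm (w - 1) \<le> \<delta>" for w
    using far [OF w] assms w by (intro power_mono norm_sum_powers_le) (auto simp: norm_mult)
  have "norm (cnj v - 1) \<le> \<delta>"
    using assms(6) by (metis complex_cnj_diff complex_cnj_one complex_mod_cnj)
  hence "fejer K v u \<le> ((2 / \<delta>)\<^sup>2 + (2 / \<delta>)\<^sup>2) / (2 * real K)"
    unfolding fejer_def using assms by (intro divide_right_mono add_mono *) auto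
  also have "\<dots> = 4 / (real K * \<delta>\<^sup>2)" using assms by (simp add: field_simps power2_eq_square)
  finally show ?thesis .
qed

text \<open>
  The hypotheses bound the Fourier coefficients of the weights only from above. If the points
  stay away from 1, comparing the Fejer sums at the centre and at a shift \<open>v\<close> inside the
  gap shows that each coefficient is also \<open>\<ge> - \<eta> T - O(1)\<close>, where \<open>T\<close> is the total mass; so the
  Fejer sum at the centre is about \<open>T\<close>, while the gap makes it at most \<open>T / 2\<close>.
\<close>
lemma mass_bounded_if_gap_at_1:
  fixes w :: "'s \<Rightarrow> 'p \<Rightarrow> real" and u :: "'p \<Rightarrow> complex"
  assumes summable: "\<And>s. s \<in> S \<Longrightarrow> w s summable_on P"
    and nonneg: "\<And>s p. s \<in> S \<Longrightarrow> p \<in> P \<Longrightarrow> w s p \<ge> 0"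
    and unit: "\<And>p. p \<in> P \<Longrightarrow> norm (u p) = 1"
    and above: "\<And>k. k \<ge> (1::nat) \<Longrightarrow> \<exists>C. \<forall>s\<in>S. (\<Sum>\<^sub>\<infinity>p\<in>P. w s p * Re (u p ^ k)) \<le> C"
    and Z: "Z \<subseteq> P" "\<And>s. s \<in> S \<Longrightarrow> (\<Sum>\<^sub>\<infinity>p\<in>Z. w s p) \<le> E"
    and gap: "\<delta> > 0" "\<And>p. p \<in> P - Z \<Longrightarrow> norm (u p - 1) \<ge> 2 * \<delta>"
  shows "\<exists>B. \<forall>s\<in>S. (\<Sum>\<^sub>\<infinity>p\<in>P. w s p) \<le> B"
proof -
  define T where "T s = (\<Sum>\<^sub>\<infinity>p\<in>P. w s p)" for s
  define c where "c s k = (\<Sum>\<^sub>\<infinity>p\<in>P. w s p * Re (u p ^ k))" for s k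
  define H where "H s K v = (\<Sum>\<^sub>\<infinity>p\<in>P. w s p * fejer K v (u p))" for s K v
  define a where "a K k = 2 * real (K - k) / real K" for K k :: nat
  have T0: "T s \<ge> 0" if "s \<in> S" for s
    unfolding T_def by (rule infsum_nonneg) (use nonneg that in auto)
  have summ: "(\<lambda>p. w s p * f p) summable_on P"
    if "s \<in> S" "\<And>p. p \<in> P \<Longrightarrow> \<bar>f p\<bar> \<le> M" for s f M
  proof -
    have "(\<lambda>p. w s p * M) summable_on P"
      using summable [OF that(1)] by (rule summable_on_cmult_left)
    hence "(\<lambda>p. norm (w s p * f p)) summable_on P"
      by (rule summable_on_comparison_test)
         (use that nonneg in \<open>auto simp: abs_mult intro!: mult_left_mono\<close>)
    thus ?thesis by (rule abs_summable_summable)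
  qed
  have re_le: "\<bar>Re (u p ^ k)\<bar> \<le> 1" if "p \<in> P" for p k
    using abs_Re_le_cmod [of "u p ^ k"] unit [OF that] by (simp add: norm_power)
  have sumc: "(\<lambda>p. w s p * Re (u p ^ k)) summable_on P" if "s \<in> S" for s k
    by (rule summ [OF that re_le])
  have sumf: "(\<lambda>p. w s p * fejer K v (u p)) summable_on P" if "s \<in> S" "norm v = 1" "K > 0" for s K v
    by (rule summ [OF that(1), of _ "real K"])
       (use that unit in \<open>auto simp: fejer_nonneg intro!: fejer_le\<close>)
  \<comment> \<open>Fourier expansion of the Fejer sum: the shift enters only through the factors
    \<open>Re (v ^ k)\<close>, while the total mass keeps coefficient 1.\<close>
  have H_eq: "H s K v = T s + (\<Sum>k=1..<K. a K k * Re (v ^ k) * c s k)"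
    if "s \<in> S" "norm v = 1" "K > 0" for s K v
  proof -
    have hs: "((\<lambda>p. w s p + (\<Sum>k=1..<K. a K k * Re (v ^ k) * (w s p * Re (u p ^ k)))) has_sum
           (T s + (\<Sum>k=1..<K. a K k * Re (v ^ k) * c s k))) P"
      unfolding T_def c_def using summable sumc that
      by (intro has_sum_add has_sum_finite_sum has_sum_cmult_right) auto
    have eq: "w s p + (\<Sum>k=1..<K. a K k * Re (v ^ k) * (w s p * Re (u p ^ k))) =
        w s p * fejer K v (u p)" if "p \<in> P" for p
      using fejer_eq [OF unit [OF that] \<open>norm v = 1\<close> \<open>K > 0\<close>]
      by (simp add: a_def distrib_left sum_distrib_left mult_ac)
    have "H s K v = (\<Sum>\<^sub>\<infinity>p\<in>P. w s p + (\<Sum>k=1..<K. a K k * Re (v ^ k) * (w s p * Re (u p ^ k))))"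
      unfolding H_def by (intro infsum_cong) (simp only: eq)
    also have "\<dots> = T s + (\<Sum>k=1..<K. a K k * Re (v ^ k) * c s k)"
      by (rule infsumI [OF hs])
    finally show ?thesis .
  qed
  have H_nonneg: "H s K v \<ge> 0" if "s \<in> S" for s K v
    unfolding H_def by (rule infsum_nonneg) (use that nonneg in \<open>auto simp: fejer_nonneg\<close>)
  \<comment> \<open>Outside \<open>Z\<close> the kernel is small by the gap; on \<open>Z\<close> it
    is at most \<open>K\<close>, and the mass there is at most \<open>E\<close>.\<close>
  have H_le: "H s K v \<le> 4 / (real K * \<delta>\<^sup>2) * T s + real K * E"
    if s: "s \<in> S" and v: "norm v = 1" "norm (v - 1) \<le> \<delta>" and K: "K > 0" for s K v
  proof -
    have sub: "w s summable_on (P - Z)" "w s summable_on Z"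
      using summable [OF s] Z(1) by (auto intro: summable_on_subset_banach)
    have subf: "(\<lambda>p. w s p * fejer K v (u p)) summable_on (P - Z)"
               "(\<lambda>p. w s p * fejer K v (u p)) summable_on Z"
      using sumf [OF s v(1) K] Z(1) by (auto intro: summable_on_subset_banach)
    have PZ: "P = (P - Z) \<union> Z" using Z(1) by auto
    have "H s K v = (\<Sum>\<^sub>\<infinity>p\<in>P-Z. w s p * fejer K v (u p)) + (\<Sum>\<^sub>\<infinity>p\<in>Z. w s p * fejer K v (u p))"
      unfolding H_def by (subst PZ, rule infsum_Un_disjoint) (use subf in auto)
    also have "(\<Sum>\<^sub>\<infinity>p\<in>P-Z. w s p * fejer K v (u p)) \<le> (\<Sum>\<^sub>\<infinity>p\<in>P-Z. w s p * (4 / (real K * \<delta>\<^sup>2)))"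
      using sub subf nonneg s unit v K gap
      by (intro infsum_mono summable_on_cmult_left mult_left_mono fejer_le_off_arc) auto
    also have "\<dots> = (\<Sum>\<^sub>\<infinity>p\<in>P-Z. w s p) * (4 / (real K * \<delta>\<^sup>2))"
      by (rule infsum_cmult_left) (use sub in auto)
    also have "\<dots> \<le> T s * (4 / (real K * \<delta>\<^sup>2))"
      unfolding T_def using sub summable nonneg s
      by (intro mult_right_mono infsum_mono_neutral) auto
    also have "(\<Sum>\<^sub>\<infinity>p\<in>Z. w s p * fejer K v (u p)) \<le> (\<Sum>\<^sub>\<infinity>p\<in>Z. w s p * real K)"
      using sub subf nonneg s unit v K Z(1)
      by (intro infsum_mono summable_on_cmult_left mult_left_mono fejer_le) auto
    also have "\<dots> = (\<Sum>\<^sub>\<infinity>p\<in>Z. w s p) * real K"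
      by (rule infsum_cmult_left) (use sub in auto)
    also have "\<dots> \<le> E * real K" using Z(2) [OF s] by (intro mult_right_mono) auto
    finally show ?thesis by (simp add: mult.commute)
  qed
  from above have "\<forall>k. \<exists>C. k \<ge> 1 \<longrightarrow> (\<forall>s\<in>S. c s k \<le> C)" unfolding c_def by blast
  then obtain C0 where C0: "\<And>k s. k \<ge> 1 \<Longrightarrow> s \<in> S \<Longrightarrow> c s k \<le> C0 k" by metis
  define C where "C k = \<bar>C0 k\<bar>" for k
  have C: "c s k \<le> C k" if "k \<ge> 1" "s \<in> S" for s k using C0 [OF that] by (simp add: C_def)
  have C_nonneg: "C k \<ge> 0" for k by (simp add: C_def)
  have below: "\<exists>A. \<forall>s\<in>S. c s k \<ge> - \<eta> * T s - A" if k: "k \<ge> 1" and \<eta>: "\<eta> > 0" for k \<eta>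
  proof -
    \<comment> \<open>The shift angle is at most \<delta>, so that \<open>v\<close> stays inside the
      gap, and at most 1 / k, so that \<open>k * t\<close> lies in (0, pi) and
      \<open>Re (v ^ k) < 1\<close>.\<close>
    define t where "t = min \<delta> (1 / real k)"
    have t: "t > 0" "t \<le> \<delta>" "real k * t \<le> 1"
      using gap k by (auto simp: t_def min_def field_simps)
    define v where "v = cis t"
    have v: "norm v = 1" by (simp add: v_def)
    have v1: "norm (v - 1) \<le> \<delta>"
    proof -
      have "norm (v - 1) \<le> \<bar>t\<bar>" unfolding v_def by (rule norm_cis_minus_1_le)
      thus ?thesis using t by simp
    qed
    define q where "q = 1 - Re (v ^ k)"
    have "cos (real k * t) < cos 0"
      using t k pi_gt3 by (intro cos_monotone_0_pi) auto
    hence q: "q > 0" unfolding q_def v_def by (simp add: Complex.DeMoivre)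
    have q_all: "1 - Re (v ^ j) \<ge> 0" for j
      using abs_Re_le_cmod [of "v ^ j"] by (simp add: norm_power v)
    \<comment> \<open>The bound \<open>2 * k\<close> makes the weight \<open>a K k\<close> at least
      1; the other one pushes the off-arc bound \<open>4 / (K * \<delta>\<^sup>2)\<close> below
      \<open>q * \<eta>\<close>.\<close>
    define K where "K = max (2 * k) (nat \<lceil>4 / (\<delta>\<^sup>2 * q * \<eta>)\<rceil>)"
    have K: "K \<ge> 2 * k" "real K \<ge> 4 / (\<delta>\<^sup>2 * q * \<eta>)"
      unfolding K_def by linarith+
    have Kpos: "K > 0" using K k by simp
    have aK: "a K j \<ge> 0" for j by (simp add: a_def)
    have ak: "a K k \<ge> 1" using K(1) k by (simp add: a_def field_simps of_nat_diff)
    define A where "A = (real K * \<bar>E\<bar> + (\<Sum>j=1..<K. a K j * (1 - Re (v ^ j)) * C j)) / q"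
    have "c s k \<ge> - \<eta> * T s - A" if s: "s \<in> S" for s
    proof -
      have v11: "norm (1::complex) = 1" "norm ((1::complex) - 1) \<le> \<delta>" using gap by auto
      \<comment> \<open>Subtracting the shifted sum cancels \<open>T s\<close> and leaves
        nonnegative weights on the coefficients; the sum at 1 is nonnegative and the shifted one is
        small.\<close>
      have "H s K 1 - H s K v = (\<Sum>j=1..<K. a K j * (1 - Re (v ^ j)) * c s j)"
        unfolding H_eq [OF s v Kpos] H_eq [OF s v11(1) Kpos]
        by (simp add: algebra_simps sum_subtractf)
      hence "(\<Sum>j=1..<K. a K j * (1 - Re (v ^ j)) * c s j) \<ge> - (4 / (real K * \<delta>\<^sup>2) * T s + real K * E)"
        using H_nonneg [OF s, of K 1] H_le [OF s v v1 Kpos] by linarith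
      \<comment> \<open>Each \<open>C j - c s j\<close> is nonnegative, so the sum dominates its
        \<open>k\<close>-th term: upper bounds on all coefficients become a lower bound on a single
        one.\<close>
      moreover have "(\<Sum>j=1..<K. a K j * (1 - Re (v ^ j)) * (C j - c s j)) \<ge> a K k * q * (C k - c s k)"
        unfolding q_def
        by (rule member_le_sum) (use K k C s q_all aK in auto)
      moreover have "(\<Sum>j=1..<K. a K j * (1 - Re (v ^ j)) * (C j - c s j)) =
         (\<Sum>j=1..<K. a K j * (1 - Re (v ^ j)) * C j) - (\<Sum>j=1..<K. a K j * (1 - Re (v ^ j)) * c s j)"
        by (simp add: right_diff_distrib sum_subtractf)
      moreover have "a K k * q * (C k - c s k) \<ge> 1 * q * (C k - c s k)"
        using ak q C [OF k s] by (intro mult_right_mono) auto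
      moreover have "q * A = real K * \<bar>E\<bar> + (\<Sum>j=1..<K. a K j * (1 - Re (v ^ j)) * C j)"
        using q by (simp add: A_def)
      moreover have "real K * E \<le> real K * \<bar>E\<bar>" by (intro mult_left_mono) auto
      ultimately have 1: "q * (C k - c s k) \<le> 4 / (real K * \<delta>\<^sup>2) * T s + q * A"
        by linarith
      have "4 / (real K * \<delta>\<^sup>2) \<le> q * \<eta>"
        using K(2) q \<eta> gap Kpos by (simp add: field_simps)
      hence "4 / (real K * \<delta>\<^sup>2) * T s \<le> q * \<eta> * T s" using T0 [OF s] by (rule mult_right_mono)
      hence "q * (C k - c s k) \<le> q * (\<eta> * T s + A)" using 1 by (simp add: algebra_simps)
      hence "C k - c s k \<le> \<eta> * T s + A" using q by simp
      thus ?thesis using C_nonneg [of k] by linarith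
    qed
    thus ?thesis by blast
  qed
  \<comment> \<open>With this \<open>K\<close> the off-arc part of the central Fejer sum is at most
    \<open>T s / 4\<close>, and with \<eta> below the lower bounds on the coefficients cost at most
    another quarter. Half of \<open>T s\<close> is left, bounded by constants.\<close>
  define K where "K = nat \<lceil>16 / \<delta>\<^sup>2\<rceil>"
  have K: "real K \<ge> 16 / \<delta>\<^sup>2" unfolding K_def by linarith
  have "16 / \<delta>\<^sup>2 > 0" using gap by simp
  hence Kpos: "K > 0" using K by (metis gr0I linorder_not_less of_nat_0)
  define \<eta> where "\<eta> = 1 / (8 * real K)"
  have \<eta>: "\<eta> > 0" using Kpos by (simp add: \<eta>_def)
  have "\<forall>k. \<exists>A. k \<ge> 1 \<longrightarrow> (\<forall>s\<in>S. c s k \<ge> - \<eta> * T s - A)" using below [OF _ \<eta>] by blast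
  then obtain A where A: "\<And>k s. k \<ge> 1 \<Longrightarrow> s \<in> S \<Longrightarrow> c s k \<ge> - \<eta> * T s - A k" by metis
  define B where "B = 2 * (real K * \<bar>E\<bar> + (\<Sum>k=1..<K. 2 * \<bar>A k\<bar>))"
  have "T s \<le> B" if s: "s \<in> S" for s
  proof -
    have a2: "0 \<le> a K k \<and> a K k \<le> 2" for k using Kpos by (simp add: a_def field_simps)
    have low: "a K k * c s k \<ge> - (2 * \<eta> * T s) - 2 * \<bar>A k\<bar>" if k: "k \<ge> 1" for k
    proof -
      have nn: "0 \<le> \<eta> * T s + \<bar>A k\<bar>" using \<eta> T0 [OF s] by simp
      have "a K k * (\<eta> * T s + \<bar>A k\<bar>) \<le> 2 * (\<eta> * T s + \<bar>A k\<bar>)"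
        using a2 nn by (intro mult_right_mono) auto
      moreover have "a K k * c s k \<ge> a K k * (- (\<eta> * T s + \<bar>A k\<bar>))"
        using a2 A [OF k s] by (intro mult_left_mono) auto
      ultimately show ?thesis unfolding mult_minus_right distrib_left by linarith
    qed
    have "(\<Sum>k=1..<K. a K k * c s k) \<ge> (\<Sum>k=1..<K. - (2 * \<eta> * T s) - 2 * \<bar>A k\<bar>)"
      by (intro sum_mono low) auto
    also have "(\<Sum>k=1..<K. - (2 * \<eta> * T s) - 2 * \<bar>A k\<bar>) =
        - (real (K - 1) * (2 * \<eta> * T s)) - (\<Sum>k=1..<K. 2 * \<bar>A k\<bar>)"
      by (simp add: sum_subtractf)
    finally have "T s - real (K - 1) * (2 * \<eta> * T s) - (\<Sum>k=1..<K. 2 * \<bar>A k\<bar>) \<le> H s K 1"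
      using H_eq [OF s _ Kpos, of 1] by simp
    moreover have "real (K - 1) * (2 * \<eta> * T s) \<le> real K * (2 * \<eta> * T s)"
      using \<eta> T0 [OF s] by (intro mult_right_mono) auto
    moreover have "real K * (2 * \<eta> * T s) = T s / 4" using Kpos by (simp add: \<eta>_def)
    moreover have "H s K 1 \<le> 4 / (real K * \<delta>\<^sup>2) * T s + real K * E"
      using gap by (intro H_le s Kpos) auto
    moreover have "4 / (real K * \<delta>\<^sup>2) * T s \<le> 1 / 4 * T s"
    proof (rule mult_right_mono [OF _ T0 [OF s]])
      show "4 / (real K * \<delta>\<^sup>2) \<le> 1 / 4" using K Kpos gap by (simp add: field_simps)
    qed
    moreover have "real K * E \<le> real K * \<bar>E\<bar>" by (intro mult_left_mono) auto
    ultimately have "T s - T s / 4 - (\<Sum>k=1..<K. 2 * \<bar>A k\<bar>) \<le> 1 / 4 * T s + real K * \<bar>E\<bar>"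
      by linarith
    thus ?thesis unfolding B_def by (simp add: field_simps)
  qed
  thus ?thesis unfolding T_def by blast
qed

subsection \<open>Hecke characters and their lattice sums\<close>

text \<open>The angular character \<open>sgn z ^ m\<close> times N(z) to the power -s, where N(z) is
  the squared modulus. Since \<open>0 powr _ = 0\<close>, the value at 0 is 0 even for
  \<open>m = 0\<close>, so lattice sums may run over the whole ring.\<close>

definition hecke :: "nat \<Rightarrow> real \<Rightarrow> complex \<Rightarrow> complex" where
  "hecke m s z = sgn z ^ m * of_real (norm z powr (- 2 * s))"

lemma hecke_mult: "hecke m s (x * y) = hecke m s x * hecke m s y"
  by (simp add: hecke_def sgn_mult power_mult_distrib norm_mult powr_mult)

lemma hecke_0 [simp]: "hecke m s 0 = 0" and hecke_1 [simp]: "hecke m s 1 = 1"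
  by (simp_all add: hecke_def)

lemma norm_hecke: "norm (hecke m s z) = norm z powr (- 2 * s)"
  by (cases "z = 0") (simp_all add: hecke_def norm_mult norm_power norm_sgn)

lemma hecke_power: "hecke m s (z ^ n) = hecke m s z ^ n"
  by (induction n) (simp_all add: hecke_mult)

section \<open>Convergence of the lattice sums\<close>

lemma power2_powr:
  fixes x :: real
  assumes "x \<ge> 0"
  shows "(x\<^sup>2) powr r = x powr (2 * r)"
proof (cases "x = 0")
  case False
  hence "x\<^sup>2 = x powr 2" using assms by (simp add: powr_numeral)
  thus ?thesis by (simp only: powr_powr)
qed simp

lemma summable_on_int_powr:
  assumes "r > 1"
  shows "(\<lambda>a::int. (1 + \<bar>real_of_int a\<bar>) powr (- r)) summable_on UNIV"
proof -
  have "summable (\<lambda>n. real n powr (- r))" using assms by (simp add: summable_real_powr_iff)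
  hence "summable (\<lambda>n. real (Suc n) powr (- r))" by (subst summable_Suc_iff)
  hence nat: "(\<lambda>n. (1 + real n) powr (- r)) summable_on UNIV"
    by (intro summable_nonneg_imp_summable_on) (simp_all add: add.commute)
  have "(\<lambda>a::int. (1 + \<bar>real_of_int a\<bar>) powr (- r)) summable_on range f"
    if f: "inj f" "\<And>n. \<bar>f n\<bar> = int n" for f :: "nat \<Rightarrow> int"
  proof -
    have "(\<lambda>a::int. (1 + \<bar>real_of_int a\<bar>) powr (- r)) \<circ> f = (\<lambda>n. (1 + real n) powr (- r))"
    proof
      fix n
      have "\<bar>real_of_int (f n)\<bar> = real n" using f(2) [of n] by (metis of_int_abs of_int_of_nat_eq)
      thus "((\<lambda>a::int. (1 + \<bar>real_of_int a\<bar>) powr (- r)) \<circ> f) n = (1 + real n) powr (- r)" by simp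
    qed
    thus ?thesis using nat f(1) by (subst summable_on_reindex) simp_all
  qed
  from this [of int] this [of "\<lambda>n. - int n"]
  have "(\<lambda>a::int. (1 + \<bar>real_of_int a\<bar>) powr (- r)) summable_on (range int \<union> range (\<lambda>n. - int n))"
    by (intro summable_on_union) (auto simp: inj_on_def)
  moreover have "range int \<union> range (\<lambda>n. - int n) = UNIV"
    by (auto simp: image_iff) (metis int_cases2)
  ultimately show ?thesis by simp
qed

text \<open>Away from the origin \<open>(1 + \<bar>a\<bar>) * (1 + \<bar>b\<bar>)\<close> is at most
  6 times the norm of \<open>eis_of (a, b)\<close>, so the lattice sum is dominated by a product of
  two convergent sums over the integers.\<close>

lemma summable_on_cmod_of_eis_powr:
  assumes "t > 2"
  shows "(\<lambda>x. cmod (of_eis x) powr (- t)) summable_on UNIV"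
proof -
  define r where "r = t / 2"
  have r: "r > 1" using assms by (simp add: r_def)
  define f where "f a = (1 + \<bar>real_of_int a\<bar>) powr (- r)" for a
  have f: "f summable_on UNIV" unfolding f_def by (rule summable_on_int_powr [OF r])
  have "(\<lambda>(a, b). f a * f b) summable_on (SIGMA a:UNIV. UNIV)"
  proof (rule summable_on_SigmaI)
    show "((\<lambda>b. case (a, b) of (a, b) \<Rightarrow> f a * f b) has_sum (f a * infsum f UNIV)) UNIV" for a
      using f by (auto intro: has_sum_cmult_right)
    show "(\<lambda>a. f a * infsum f UNIV) summable_on UNIV"
      using f by (rule summable_on_cmult_left)
  qed (auto simp: f_def)
  hence "(\<lambda>(a, b). f a * f b * 6 powr r) summable_on UNIV"
    by (simp add: case_prod_unfold summable_on_cmult_left)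
  hence "(\<lambda>p. cmod (of_eis (eis_of p)) powr (- t)) summable_on UNIV"
  proof (rule summable_on_comparison_test)
    fix p :: "int \<times> int"
    obtain a b where p: "p = (a, b)" by (cases p)
    show "cmod (of_eis (eis_of p)) powr (- t) \<le> (case p of (a, b) \<Rightarrow> f a * f b * 6 powr r)"
    proof (cases "p = (0, 0)")
      case True
      thus ?thesis by (simp add: eis_of_def f_def)
    next
      case False
      define x where "x = real_of_int a"
      define y where "y = real_of_int b"
      define N where "N = (cmod (of_eis (eis_of p)))\<^sup>2"
      have N: "N = x\<^sup>2 + x * y + y\<^sup>2" unfolding N_def p cmod_eis_of by (simp add: x_def y_def)
      have "a\<^sup>2 + b\<^sup>2 \<ge> 1" using False by (simp add: p) (smt (verit) zero_le_power2 zero_eq_power2)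
      hence "real_of_int (a\<^sup>2 + b\<^sup>2) \<ge> 1" by linarith
      hence xy: "x\<^sup>2 + y\<^sup>2 \<ge> 1" by (simp add: x_def y_def)
      have "(x + y)\<^sup>2 \<ge> 0" by simp
      hence N2: "2 * N \<ge> x\<^sup>2 + y\<^sup>2" unfolding N by (simp add: power2_eq_square algebra_simps)
      have "(1 + \<bar>x\<bar>) * (1 + \<bar>y\<bar>) \<le> 2 + x\<^sup>2 + y\<^sup>2"
      proof -
        have "(\<bar>x\<bar> - \<bar>y\<bar>)\<^sup>2 \<ge> 0" "(\<bar>x\<bar> - 1)\<^sup>2 \<ge> 0" "(\<bar>y\<bar> - 1)\<^sup>2 \<ge> 0" by simp_all
        thus ?thesis by (simp add: power2_diff algebra_simps)
      qed
      also have "\<dots> \<le> 6 * N" using N2 xy by simp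
      finally have le: "(1 + \<bar>x\<bar>) * (1 + \<bar>y\<bar>) \<le> 6 * N" .
      have pos: "(1 + \<bar>x\<bar>) * (1 + \<bar>y\<bar>) > 0" by (intro mult_pos_pos) auto
      have Npos: "N > 0" using N2 xy by simp
      have "cmod (of_eis (eis_of p)) powr (- t) = N powr (- r)"
        by (simp add: N_def power2_powr r_def)
      also have "\<dots> = (6 * N) powr (- r) * 6 powr r"
        using Npos by (simp add: powr_mult powr_minus)
      also have "\<dots> \<le> ((1 + \<bar>x\<bar>) * (1 + \<bar>y\<bar>)) powr (- r) * 6 powr r"
        using le pos r by (intro mult_right_mono powr_mono2') auto
      also have "\<dots> = f a * f b * 6 powr r" by (simp add: powr_mult f_def x_def y_def)
      finally show ?thesis by (simp add: p)
    qed
  qed simp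
  thus ?thesis using summable_on_reindex_bij_betw [OF bij_eis_of] by fast
qed

lemma hecke_abs_summable:
  assumes "s > 1"
  shows "(\<lambda>x. norm (hecke m s (of_eis x))) summable_on A"
  using summable_on_cmod_of_eis_powr [of "2 * s"] assms
  by (auto simp: norm_hecke intro: summable_on_subset_banach)

lemma hecke_summable:
  assumes "s > 1"
  shows "(\<lambda>x. hecke m s (of_eis x)) summable_on A"
  using hecke_abs_summable [OF assms] by (rule abs_summable_summable)

section \<open>Variation of the characters between neighbouring points\<close>

lemma powr_diff_le:
  fixes p q \<rho> a :: real
  assumes "0 < \<rho>" "\<rho> \<le> p" "\<rho> \<le> q" "a \<ge> 0"
  shows "\<bar>p powr (- a) - q powr (- a)\<bar> \<le> a * \<rho> powr (- a - 1) * \<bar>p - q\<bar>"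
proof -
  have "norm (p powr (- a) - q powr (- a)) \<le> a * \<rho> powr (- a - 1) * norm (p - q)"
  proof (rule field_differentiable_bound [of "{\<rho>..}"])
    fix x assume x: "x \<in> {\<rho>..}"
    show "((\<lambda>x. x powr (- a)) has_field_derivative (- a) * x powr (- a - 1)) (at x within {\<rho>..})"
      using x assms(1) by (auto intro!: derivative_eq_intros)
    have "x powr (- a - 1) \<le> \<rho> powr (- a - 1)"
      using x assms by (intro powr_mono2') auto
    thus "norm ((- a) * x powr (- a - 1)) \<le> a * \<rho> powr (- a - 1)"
      using assms(4) by (simp add: abs_mult mult_left_mono)
  qed (use assms in auto)
  thus ?thesis by simp
qed

lemma norm_sgn_diff_le:
  fixes z w :: complex
  assumes "z \<noteq> 0" "w \<noteq> 0"
  shows "norm (sgn w - sgn z) \<le> 2 * norm (w - z) / norm z"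
proof -
  have "sgn w - sgn z = (w - z) / of_real (norm z) + w * of_real (1 / norm w - 1 / norm z)"
    using assms by (simp add: sgn_eq field_simps)
  also have "norm \<dots> \<le> norm ((w - z) / of_real (norm z)) + norm (w * of_real (1 / norm w - 1 / norm z))"
    by (rule norm_triangle_ineq)
  also have "norm (w * of_real (1 / norm w - 1 / norm z)) = \<bar>norm z - norm w\<bar> / norm z"
  proof -
    have "norm (w * of_real (1 / norm w - 1 / norm z)) = \<bar>norm w * (1 / norm w - 1 / norm z)\<bar>"
      by (simp only: norm_mult norm_of_real abs_mult abs_norm_cancel)
    also have "norm w * (1 / norm w - 1 / norm z) = (norm z - norm w) / norm z"
      using assms by (simp add: field_simps)
    finally show ?thesis by simp
  qed
  also have "\<dots> \<le> norm (w - z) / norm z"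
    using norm_triangle_ineq3 [of w z] by (intro divide_right_mono) auto
  finally show ?thesis by (simp add: norm_divide)
qed

text \<open>Radial and angular part each gain a factor of order 1 / \<open>norm z\<close> under a
  bounded displacement. The exponent 3 exceeds the lattice dimension 2, so these errors are summable
  uniformly in \<open>s\<close>. The condition on \<open>w\<close> is the one that lattice points
  satisfy.\<close>

lemma hecke_diff_le:
  assumes s: "1 \<le> s" "s \<le> 2" and z: "norm z \<ge> 1" and w: "w = 0 \<or> norm w \<ge> 1"
    and d: "norm (w - z) \<le> d"
  shows "norm (hecke m s w - hecke m s z) \<le> d * (1 + 2 * real m + 4 * (1 + d) ^ 5) * norm z powr (- 3)"
proof -
  have d0: "d \<ge> 0" using d norm_ge_zero order_trans by blast
  have z0: "z \<noteq> 0" using z by auto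
  have zs: "norm z powr (- 2 * s - 1) \<le> norm z powr (- 3)"
    using z s by (intro powr_mono) auto
  have zq: "norm z powr (- 2 * s) = norm z * norm z powr (- 2 * s - 1)"
    using z0 powr_add [of "norm z" 1 "- 2 * s - 1"] by simp
  show ?thesis
  proof (cases "w = 0")
    case True
    have "norm (hecke m s w - hecke m s z) = norm z * norm z powr (- 2 * s - 1)"
      using True zq by (simp add: norm_hecke)
    also have "\<dots> \<le> d * norm z powr (- 3)"
      using True d zs d0 by (intro mult_mono) auto
    also have "\<dots> = d * 1 * norm z powr (- 3)" by simp
    also have "\<dots> \<le> d * (1 + 2 * real m + 4 * (1 + d) ^ 5) * norm z powr (- 3)"
      using d0 by (intro mult_right_mono mult_left_mono) auto
    finally show ?thesis .
  next
    case False
    hence w1: "norm w \<ge> 1" using w by simp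
    \<comment> \<open>A common lower bound for both moduli:
      \<open>norm z \<le> norm w + d \<le> (1 + d) * norm w\<close>, because
      \<open>norm w \<ge> 1\<close>.\<close>
    define \<rho> where "\<rho> = norm z / (1 + d)"
    have \<rho>0: "\<rho> > 0" using z0 d0 by (simp add: \<rho>_def)
    have \<rho>z: "\<rho> \<le> norm z" using d0 z by (simp add: \<rho>_def field_simps)
    have "norm z \<le> norm w + norm (w - z)" by (metis norm_minus_commute norm_triangle_sub)
    also have "\<dots> \<le> norm w + norm w * d"
      using d d0 w1 mult_right_mono [of 1 "norm w" d] by simp
    finally have \<rho>w: "\<rho> \<le> norm w" using d0 by (simp add: \<rho>_def field_simps)
    have "hecke m s w - hecke m s z =
        sgn w ^ m * of_real (norm w powr (- 2 * s) - norm z powr (- 2 * s)) +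
        (sgn w ^ m - sgn z ^ m) * of_real (norm z powr (- 2 * s))"
      by (simp add: hecke_def algebra_simps)
    also have "norm \<dots> \<le> norm (sgn w ^ m * of_real (norm w powr (- 2 * s) - norm z powr (- 2 * s))) +
        norm ((sgn w ^ m - sgn z ^ m) * of_real (norm z powr (- 2 * s)))"
      by (rule norm_triangle_ineq)
    also have "norm (sgn w ^ m * of_real (norm w powr (- 2 * s) - norm z powr (- 2 * s)))
        = \<bar>norm w powr (- (2 * s)) - norm z powr (- (2 * s))\<bar>"
      using False by (simp only: norm_mult norm_power norm_sgn norm_of_real) simp
    also have "\<dots> \<le> 2 * s * \<rho> powr (- (2 * s) - 1) * \<bar>norm w - norm z\<bar>"
      using s by (intro powr_diff_le \<rho>0 \<rho>z \<rho>w) auto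
    also have "\<dots> \<le> 4 * ((1 + d) ^ 5 * norm z powr (- 3)) * d"
    proof (intro mult_mono)
      have "\<rho> powr (- (2 * s) - 1) = norm z powr (- 2 * s - 1) * (1 + d) powr (2 * s + 1)"
        using d0 z0 by (simp add: \<rho>_def powr_divide powr_minus field_simps powr_diff powr_add)
      also have "\<dots> \<le> norm z powr (- 3) * (1 + d) powr 5"
        using zs s d0 z by (intro mult_mono powr_mono) auto
      finally show "\<rho> powr (- (2 * s) - 1) \<le> (1 + d) ^ 5 * norm z powr (- 3)"
        using d0 by (simp add: powr_numeral mult.commute)
      show "\<bar>norm w - norm z\<bar> \<le> d" using norm_triangle_ineq3 [of w z] d by simp
    qed (use s d0 z in auto)
    also have "norm ((sgn w ^ m - sgn z ^ m) * of_real (norm z powr (- 2 * s))) \<le>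
        real m * (2 * d / norm z) * norm z powr (- 2 * s)"
    proof -
      have "norm (sgn w ^ m - sgn z ^ m) \<le> real m * norm (sgn w - sgn z)"
        by (rule norm_power_diff) (simp_all add: norm_sgn)
      also have "norm (sgn w - sgn z) \<le> 2 * norm (w - z) / norm z"
        by (rule norm_sgn_diff_le) (use z0 False in auto)
      also have "\<dots> \<le> 2 * d / norm z" using d by (intro divide_right_mono) auto
      finally have "norm (sgn w ^ m - sgn z ^ m) \<le> real m * (2 * d / norm z)"
        by (simp add: mult_left_mono)
      thus ?thesis unfolding norm_mult by (intro mult_mono) (use d0 in auto)
    qed
    also have "real m * (2 * d / norm z) * norm z powr (- 2 * s) = 2 * real m * d * norm z powr (- 2 * s - 1)"
      using z0 unfolding zq by simp
    also have "\<dots> \<le> 2 * real m * d * norm z powr (- 3)"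
      using zs d0 by (intro mult_left_mono) auto
    finally have "norm (hecke m s w - hecke m s z) \<le>
        4 * ((1 + d) ^ 5 * norm z powr (- 3)) * d + 2 * real m * d * norm z powr (- 3)" by simp
    also have "\<dots> \<le> 4 * ((1 + d) ^ 5 * norm z powr (- 3)) * d + 2 * real m * d * norm z powr (- 3)
        + d * norm z powr (- 3)" using d0 by simp
    also have "\<dots> = d * (1 + 2 * real m + 4 * (1 + d) ^ 5) * norm z powr (- 3)"
      by (simp add: algebra_simps)
    finally show ?thesis .
  qed
qed

text \<open>The coefficient of \<open>omega_eis\<close> in \<beta> is 1, so subtracting
  \<open>b * \<beta>\<close> turns \<open>eis_of (a, b)\<close> into the integer
  \<open>a - b * M\<close>: residues modulo \<beta> are integers modulo its norm \<open>N\<close>.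
  The auxiliary \<open>\<beta>'\<close> is the conjugate of \<beta>.\<close>

lemma eis_coset_decomposition:
  fixes M :: nat
  defines "\<beta> \<equiv> of_nat M + omega_eis" and "N \<equiv> M\<^sup>2 + M + 1"
  shows "bij_betw (\<lambda>(r, q). \<beta> * q + of_nat r) ({..<N} \<times> UNIV) UNIV"
proof -
  define \<beta>' where "\<beta>' = of_nat M + 1 - omega_eis"
  have \<beta>\<beta>': "\<beta> * \<beta>' = of_nat N"
  proof -
    have "\<beta> * \<beta>' = of_nat M * of_nat M + of_nat M + (omega_eis - omega_eis * omega_eis)"
      by (simp add: \<beta>_def \<beta>'_def algebra_simps)
    thus ?thesis by (simp add: omega_eis_square N_def power2_eq_square)
  qed
  have N0: "N > 0" by (simp add: N_def)
  have \<beta>0: "\<beta> \<noteq> 0"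
  proof
    assume "\<beta> = 0"
    hence "of_eis (of_nat N) = 0" using \<beta>\<beta>' by simp
    thus False using N0 by simp
  qed
  show ?thesis
  proof (rule bij_betwI')
    fix p p' :: "nat \<times> eis"
    assume "p \<in> {..<N} \<times> UNIV" "p' \<in> {..<N} \<times> UNIV"
    then obtain r q r' q' where p: "p = (r, q)" "r < N" "p' = (r', q')" "r' < N" by auto
    show "((case p of (r, q) \<Rightarrow> \<beta> * q + of_nat r) = (case p' of (r, q) \<Rightarrow> \<beta> * q + of_nat r)) = (p = p')"
    proof
      assume "(case p of (r, q) \<Rightarrow> \<beta> * q + of_nat r) = (case p' of (r, q) \<Rightarrow> \<beta> * q + of_nat r)"
      hence eq: "\<beta> * q + of_nat r = \<beta> * q' + of_nat r'" by (simp add: p)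
      define e where "e = int r - int r'"
      have e: "of_int e = \<beta> * (q' - q)" using eq by (simp add: e_def algebra_simps)
      obtain a b where ab: "q' - q = eis_of (a, b)" by (rule eis_of_cases)
      have "of_int e * \<beta>' = of_nat N * eis_of (a, b)"
        unfolding e ab [symmetric] \<beta>\<beta>' [symmetric] by (simp add: mult_ac)
      hence "eis_of (e * (int M + 1), - e) = eis_of (int N * a, int N * b)"
        by (simp add: eis_of_def \<beta>'_def algebra_simps)
      hence "(e * (int M + 1), - e) = (int N * a, int N * b)"
        using bij_eis_of by (simp add: bij_def inj_def)
      \<comment> \<open>The second coordinate reads \<open>- e = int N * b\<close>.\<close>
      hence dvd: "int N dvd e" by (metis Pair_inject dvd_minus_iff dvd_triv_left)
      have "\<bar>e\<bar> < int N" using p by (auto simp: e_def)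
      hence "e = 0" using dvd by (metis abs_ge_zero dvd_abs_iff zdvd_not_zless abs_0_eq order_le_less)
      moreover from this have "q = q'" using e \<beta>0 by simp
      ultimately show "p = p'" by (simp add: p e_def)
    qed simp
  next
    fix x :: eis
    obtain a b where x: "x = eis_of (a, b)" by (rule eis_of_cases)
    define e where "e = a - b * int M"
    define r where "r = nat (e mod int N)"
    define q where "q = of_int b + \<beta>' * of_int (e div int N)"
    have "int r = e mod int N" using N0 by (simp add: r_def)
    hence e: "e = int N * (e div int N) + int r" by simp
    have "x = \<beta> * of_int b + of_int e" by (simp add: x eis_of_def e_def \<beta>_def algebra_simps)
    also have "of_int e = of_int (int N * (e div int N) + int r)" using e by simp
    also have "\<dots> = \<beta> * \<beta>' * of_int (e div int N) + of_nat r" by (simp add: \<beta>\<beta>')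
    also have "\<beta> * of_int b + (\<beta> * \<beta>' * of_int (e div int N) + of_nat r) = \<beta> * q + of_nat r"
      by (simp add: q_def algebra_simps)
    finally have "x = \<beta> * q + of_nat r" .
    moreover have "r < N" using N0 by (simp add: r_def nat_less_iff)
    ultimately show "\<exists>p\<in>{..<N} \<times> UNIV. x = (case p of (r, q) \<Rightarrow> \<beta> * q + of_nat r)"
      by (intro bexI [of _ "(r, q)"]) auto
  qed auto
qed

text \<open>
  Splitting the lattice into the cosets of the ideal generated by \<open>\<beta>\<close> changes each term by \<open>O(|z|\<^sup>-\<^sup>3)\<close> only, so the
  lattice sum \<open>L\<close> satisfies \<open>L = N(\<beta>) hecke(\<beta>) L + O(1)\<close>; the angle of \<open>\<beta>\<close> is chosen
  such that \<open>N(\<beta>) hecke(\<beta>)\<close> stays away from 1 as \<open>s \<rightarrow> 1\<close>.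
\<close>
lemma hecke_lattice_sum_bounded:
  assumes m: "m \<ge> 1"
  shows "\<exists>C. \<forall>s. 1 < s \<and> s \<le> 2 \<longrightarrow> norm (\<Sum>\<^sub>\<infinity>x. hecke m s (of_eis x)) \<le> C"
proof -
  \<comment> \<open>The exponent \<open>m\<close> also serves as the integer part of \<beta>: its
    argument \<theta> is then at most 1 / m, so \<open>m * \<theta>\<close> lies in (0, 1] and
    \<open>sgn b ^ m\<close> has positive imaginary part.\<close>
  define N where "N = m\<^sup>2 + m + 1"
  define \<beta> :: eis where "\<beta> = of_nat m + omega_eis"
  define b where "b = of_eis \<beta>"
  have Npos: "N > 0" by (simp add: N_def)
  have b: "b = Complex (real m + 1 / 2) (sqrt 3 / 2)"
    by (simp add: b_def \<beta>_def omega_eq complex_eq_iff)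
  have "b = of_real (real m) + of_real 1 * omega" by (simp add: b_def \<beta>_def)
  hence norm_b2: "(norm b)\<^sup>2 = real N"
    using cmod_add_mult_omega [of "real m" 1] by (simp add: N_def)
  hence b0: "b \<noteq> 0" using Npos by auto
  define \<theta> where "\<theta> = Arg b"
  have \<theta>: "\<theta> = arctan (sqrt 3 / 2 / (real m + 1 / 2))"
    unfolding \<theta>_def by (subst arg_conv_arctan) (simp_all add: b)
  have "\<theta> > 0" unfolding \<theta> by simp
  have "\<theta> \<le> sqrt 3 / 2 / (real m + 1 / 2)" unfolding \<theta> by (intro arctan_le_self) simp
  also have "\<dots> \<le> 1 / real m"
  proof (rule frac_le)
    have "sqrt 3 \<le> sqrt 4" by (rule real_sqrt_le_mono) simp
    thus "sqrt 3 / 2 \<le> 1" by simp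
  qed (use m in auto)
  finally have "real m * \<theta> \<le> 1" using m by (simp add: field_simps)
  hence "sin (real m * \<theta>) > 0" using \<open>\<theta> > 0\<close> m pi_gt3 by (intro sin_gt_zero) auto
  define \<sigma> where "\<sigma> = sin (real m * \<theta>)"
  have \<sigma>: "\<sigma> > 0" unfolding \<sigma>_def by fact
  have "sgn b = cis \<theta>" unfolding \<theta>_def using b0 by (simp add: cis_Arg)
  hence Im_sgn: "Im (sgn b ^ m) = \<sigma>" by (simp add: Complex.DeMoivre \<sigma>_def)
  \<comment> \<open>The constant of \<open>hecke_diff_le\<close> for displacements of size at most
    \<open>N\<close>, the residues being below \<open>N\<close>. In \<open>g\<close> the extra 1
    covers \<open>q = 0\<close>, where the other summand vanishes.\<close>
  define c where "c = real N * (1 + 2 * real m + 4 * (1 + real N) ^ 5)"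
  have c0: "c \<ge> 0" by (simp add: c_def)
  define g where "g q = c * cmod (of_eis q) powr (- 3) + (if q = 0 then 1 else 0)" for q
  have g_summable: "g summable_on UNIV"
    unfolding g_def
  proof (rule summable_on_add)
    show "(\<lambda>q. c * cmod (of_eis q) powr (- 3)) summable_on UNIV"
      by (intro summable_on_cmult_right summable_on_cmod_of_eis_powr) simp
    have "(\<lambda>q::eis. if q = 0 then 1 else (0::real)) summable_on {0}" by simp
    thus "(\<lambda>q::eis. if q = 0 then 1 else (0::real)) summable_on UNIV"
      by (rule summable_on_cong_neutral [THEN iffD1, rotated -1]) auto
  qed
  define G where "G = infsum g UNIV"
  have "norm (\<Sum>\<^sub>\<infinity>x. hecke m s (of_eis x)) \<le> real N * G * real N / \<sigma>" if s: "1 < s" "s \<le> 2" for s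
  proof -
    define h where "h x = hecke m s (of_eis x)" for x
    define L where "L = infsum h UNIV"
    have h_summable: "h summable_on UNIV" unfolding h_def using s by (intro hecke_summable) auto
    have bij: "bij_betw (\<lambda>(r, q). \<beta> * q + of_nat r) ({..<N} \<times> UNIV) UNIV"
      using eis_coset_decomposition [of m] unfolding \<beta>_def N_def .
    have split_summable: "(\<lambda>(r, q). h (\<beta> * q + of_nat r)) summable_on ({..<N} \<times> UNIV)"
      using summable_on_reindex_bij_betw [OF bij, of h] h_summable by (simp add: case_prod_unfold)
    have row_summable: "(\<lambda>q. h (\<beta> * q + of_nat r)) summable_on UNIV" if "r < N" for r
      using summable_on_SigmaD1 [OF split_summable] that by auto
    have "L = (\<Sum>\<^sub>\<infinity>(r, q)\<in>{..<N} \<times> UNIV. h (\<beta> * q + of_nat r))"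
      unfolding L_def using infsum_reindex_bij_betw [OF bij, of h] by (simp add: case_prod_unfold)
    also have "\<dots> = (\<Sum>\<^sub>\<infinity>r\<in>{..<N}. \<Sum>\<^sub>\<infinity>q. h (\<beta> * q + of_nat r))"
      by (rule infsum_Sigma'_banach [OF split_summable, symmetric])
    also have "\<dots> = (\<Sum>r<N. \<Sum>\<^sub>\<infinity>q. h (\<beta> * q + of_nat r))" by (rule infsum_finite) simp
    finally have L_split: "L = (\<Sum>r<N. \<Sum>\<^sub>\<infinity>q. h (\<beta> * q + of_nat r))" .
    have hb: "h (\<beta> * q) = hecke m s b * h q" for q by (simp add: h_def b_def hecke_mult)
    have row: "norm ((\<Sum>\<^sub>\<infinity>q. h (\<beta> * q + of_nat r)) - hecke m s b * L) \<le> G" if r: "r < N" for r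
    proof (rule norm_infsum_le)
      show "((\<lambda>q. h (\<beta> * q + of_nat r) - hecke m s b * h q) has_sum
          ((\<Sum>\<^sub>\<infinity>q. h (\<beta> * q + of_nat r)) - hecke m s b * L)) UNIV"
        unfolding L_def using row_summable [OF r] h_summable
        unfolding diff_conv_add_uminus
        by (intro has_sum_add has_sum_uminusI has_sum_cmult_right) auto
      show "(g has_sum G) UNIV" unfolding G_def using g_summable by simp
      fix q :: eis
      show "norm (h (\<beta> * q + of_nat r) - hecke m s b * h q) \<le> g q"
      proof (cases "q = 0")
        case True
        have "norm (hecke m s (of_nat r)) \<le> 1"
        proof (cases "r = 0")
          case False
          hence "real r powr (- 2 * s) \<le> real r powr 0" using s by (intro powr_mono) auto
          thus ?thesis using False by (simp add: norm_hecke)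
        qed simp
        thus ?thesis using True by (simp add: g_def h_def)
      next
        case False
        define z where "z = b * of_eis q"
        define w where "w = z + of_nat r"
        have q1: "norm (of_eis q) \<ge> 1" using False by (rule cmod_of_eis_ge_1)
        have "real N \<ge> 1" using Npos by simp
        hence b1: "norm b \<ge> 1" unfolding norm_b2 [symmetric]
          by (intro power2_le_imp_le [of 1]) simp_all
        have zq: "norm z \<ge> norm (of_eis q)" using b1 mult_right_mono [OF b1, of "norm (of_eis q)"]
          by (simp add: z_def norm_mult)
        have "norm (hecke m s w - hecke m s z) \<le> real N * (1 + 2 * real m + 4 * (1 + real N) ^ 5) * norm z powr (- 3)"
        proof (rule hecke_diff_le)
          show "w = 0 \<or> 1 \<le> cmod w"
            using cmod_of_eis_ge_1 [of "\<beta> * q + of_nat r"]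
            by (cases "\<beta> * q + of_nat r = 0") (auto simp: w_def z_def b_def simp flip: of_eis_eq_0_iff)
        qed (use s zq q1 r in \<open>auto simp: w_def\<close>)
        also have "\<dots> \<le> c * cmod (of_eis q) powr (- 3)"
          unfolding c_def [symmetric] using zq q1 c0 by (intro mult_left_mono powr_mono2') auto
        finally show ?thesis using False
          by (simp add: g_def h_def w_def z_def b_def hecke_mult)
      qed
    qed
    have "L - of_nat N * hecke m s b * L = (\<Sum>r<N. (\<Sum>\<^sub>\<infinity>q. h (\<beta> * q + of_nat r)) - hecke m s b * L)"
      unfolding sum_subtractf using L_split by simp
    also have "norm \<dots> \<le> (\<Sum>r<N. G)" by (intro sum_norm_le row) auto
    finally have "norm (L * (1 - of_nat N * hecke m s b)) \<le> real N * G" by (simp add: algebra_simps)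
    hence up: "norm L * norm (1 - of_nat N * hecke m s b) \<le> real N * G" by (simp only: norm_mult)
    \<comment> \<open>The imaginary part of \<open>N * hecke m s b\<close> is
      \<open>\<sigma> * N powr (1 - s)\<close>, at least \<open>\<sigma> / N\<close> for
      \<open>s \<le> 2\<close>; this keeps the factor of \<open>L\<close> away from 0.\<close>
    have "norm b powr (- 2 * s) = real N powr (- s)"
      unfolding norm_b2 [symmetric] by (simp add: power2_powr)
    hence "Im (of_nat N * hecke m s b) = real N * (\<sigma> * real N powr (- s))"
      by (simp add: hecke_def Im_sgn)
    also have "\<dots> = \<sigma> * real N powr (1 - s)" using Npos by (simp add: powr_diff powr_minus field_simps)
    also have "\<dots> \<ge> \<sigma> * real N powr (- 1)"
      using s Npos \<sigma> by (intro mult_left_mono powr_mono) auto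
    finally have "\<sigma> / real N \<le> \<bar>Im (1 - of_nat N * hecke m s b)\<bar>"
      using Npos by (simp add: powr_minus divide_inverse)
    also have "\<dots> \<le> norm (1 - of_nat N * hecke m s b)" by (rule abs_Im_le_cmod)
    finally have "norm L * (\<sigma> / real N) \<le> norm L * norm (1 - of_nat N * hecke m s b)"
      by (rule mult_left_mono) simp
    hence "norm L * (\<sigma> / real N) \<le> real N * G" using up by linarith
    hence "norm L \<le> real N * G * real N / \<sigma>" using \<sigma> Npos by (simp add: field_simps)
    thus ?thesis by (simp only: L_def h_def [abs_def])
  qed
  thus ?thesis by blast
qed

text \<open>In the triangle \<open>1 \<le> b \<le> a \<le> n\<close> the norm is at most
  \<open>3 * a\<^sup>2\<close>, so the row of \<open>a\<close> contributes at least
  \<open>1 / (3 * a)\<close>, and the harmonic series diverges.\<close>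

lemma lattice_inverse_square_unbounded:
  "\<exists>F. finite F \<and> 0 \<notin> F \<and> (\<Sum>x\<in>F. cmod (of_eis x) powr (- 2)) \<ge> B"
proof -
  have "eventually (\<lambda>n. harm n \<ge> 3 * B) sequentially"
    using harm_at_top by (simp add: filterlim_at_top)
  then obtain n where n: "harm n \<ge> 3 * B" by (auto simp: eventually_sequentially)
  define I where "I = (SIGMA a:{1..n}. {1..a})"
  define e where "e = (\<lambda>(a, b). eis_of (int a, int b))"
  define F where "F = e ` I"
  have inj: "inj_on e I"
  proof (rule inj_onI)
    fix p q assume "e p = e q"
    hence "(int (fst p), int (snd p)) = (int (fst q), int (snd q))"
      using bij_eis_of by (simp add: e_def case_prod_unfold bij_def inj_eq del: of_nat_eq_iff)
    thus "p = q" by (simp add: prod_eq_iff)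
  qed
  have "0 \<notin> F"
  proof
    assume "0 \<in> F"
    then obtain a b where ab: "(a, b) \<in> I" "eis_of (int a, int b) = 0"
      by (auto simp: F_def e_def)
    have "eis_of (int a, int b) = eis_of (0, 0)" using ab(2) by (simp add: eis_of_def)
    hence "a = 0" using bij_eis_of by (simp add: bij_def inj_eq)
    thus False using ab(1) by (simp add: I_def)
  qed
  moreover have "finite F" unfolding F_def I_def by simp
  moreover have "(\<Sum>x\<in>F. cmod (of_eis x) powr (- 2)) \<ge> B"
  proof -
    have "(\<Sum>x\<in>F. cmod (of_eis x) powr (- 2)) = (\<Sum>(a, b)\<in>I. cmod (of_eis (eis_of (int a, int b))) powr (- 2))"
      unfolding F_def sum.reindex [OF inj] by (simp add: e_def case_prod_unfold)
    also have "\<dots> \<ge> (\<Sum>(a, b)\<in>I. 1 / (3 * (real a)\<^sup>2))"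
    proof (rule sum_mono, clarify)
      fix a b assume "(a, b) \<in> I"
      hence ab: "1 \<le> a" "1 \<le> b" "b \<le> a" by (auto simp: I_def)
      define N where "N = (cmod (of_eis (eis_of (int a, int b))))\<^sup>2"
      have N: "N = (real a)\<^sup>2 + real a * real b + (real b)\<^sup>2"
        unfolding N_def cmod_eis_of by simp
      have "real a * real b \<le> real a * real a" "(real b)\<^sup>2 \<le> (real a)\<^sup>2"
        using ab by (auto intro: mult_left_mono power_mono)
      hence "N \<le> 3 * (real a)\<^sup>2" by (simp add: N power2_eq_square)
      moreover have "N > 0" using ab unfolding N by (intro add_pos_nonneg) auto
      ultimately have "1 / (3 * (real a)\<^sup>2) \<le> 1 / N" by (intro divide_left_mono mult_pos_pos) (use ab in auto)
      also have "1 / N = cmod (of_eis (eis_of (int a, int b))) powr (- 2)"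
        using \<open>N > 0\<close> by (simp add: N_def powr_minus powr_numeral divide_inverse)
      finally show "1 / (3 * (real a)\<^sup>2) \<le> cmod (of_eis (eis_of (int a, int b))) powr (- 2)" .
    qed
    also have "(\<Sum>(a, b)\<in>I. 1 / (3 * (real a)\<^sup>2)) = (\<Sum>a=1..n. \<Sum>b=1..a. 1 / (3 * (real a)\<^sup>2))"
      unfolding I_def by (rule sum.Sigma [symmetric]) auto
    also have "\<dots> = (\<Sum>a=1..n. inverse (real a) / 3)"
      by (intro sum.cong refl) (simp add: power2_eq_square field_simps)
    also have "\<dots> = harm n / 3" unfolding harm_def sum_divide_distrib ..
    finally show ?thesis using n by simp
  qed
  ultimately show ?thesis by blast
qed

subsection \<open>Euler products\<close>

text \<open>As \<open>prime\<close> requires a normalized element, it selects one prime from each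
  class of associates. The set is closed under multiplication by units, whence the factor
  \<open>num_units\<close> in the Euler products.\<close>

definition prime_supported :: "eis set \<Rightarrow> eis set" where
  "prime_supported Q = {x. x \<noteq> 0 \<and> (\<forall>p. prime p \<longrightarrow> p dvd x \<longrightarrow> p \<in> Q)}"

lemma prime_supported_empty: "prime_supported {} = {x. x dvd 1}"
proof -
  have "x \<in> prime_supported {} \<longleftrightarrow> x dvd 1" for x
  proof
    assume "x \<in> prime_supported {}"
    thus "x dvd 1" using prime_divisor_exists [of x] by (auto simp: prime_supported_def)
  next
    assume x: "x dvd 1"
    have "\<not> p dvd x" if "prime p" for p :: eis
    proof
      assume "p dvd x"
      hence "p dvd 1" using x by (rule dvd_trans)
      thus False using that not_prime_unit by simp
    qed
    moreover have "x \<noteq> 0" using x by auto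
    ultimately show "x \<in> prime_supported {}" by (auto simp: prime_supported_def)
  qed
  thus ?thesis by auto
qed

text \<open>Splitting off the exact power of the new prime; this passes from \<open>Q\<close> to
  \<open>insert q Q\<close> in the Euler product.\<close>

lemma bij_betw_prime_supported_insert:
  assumes Q: "Q \<subseteq> {p. prime p}" and q: "prime q" "q \<notin> Q"
  shows "bij_betw (\<lambda>(j, x). q ^ j * x) (UNIV \<times> prime_supported Q) (prime_supported (insert q Q))"
proof -
  have q0: "q \<noteq> 0" using q by auto
  have ndvd: "\<not> q dvd x" if "x \<in> prime_supported Q" for x
    using that q by (auto simp: prime_supported_def)
  have key: "j = j' \<and> x = x'"
    if x: "x \<in> prime_supported Q" "x' \<in> prime_supported Q" and eq: "q ^ j * x = q ^ j' * x'" and le: "j \<le> j'"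
    for j j' x x'
  proof -
    have "q ^ j * x = q ^ j * (q ^ (j' - j) * x')" using eq le by (simp flip: power_add mult.assoc)
    hence x_eq: "x = q ^ (j' - j) * x'" using q0 by simp
    have "j' - j = 0"
    proof (rule ccontr)
      assume "j' - j \<noteq> 0"
      hence "q dvd q ^ (j' - j)" by (intro dvd_power) auto
      hence "q dvd x" unfolding x_eq by simp
      thus False using ndvd x by blast
    qed
    thus ?thesis using x_eq le by simp
  qed
  show ?thesis
  proof (rule bij_betwI')
    fix a b :: "nat \<times> eis"
    assume ab: "a \<in> UNIV \<times> prime_supported Q" "b \<in> UNIV \<times> prime_supported Q"
    show "((case a of (j, x) \<Rightarrow> q ^ j * x) = (case b of (j, x) \<Rightarrow> q ^ j * x)) = (a = b)"
    proof
      assume "(case a of (j, x) \<Rightarrow> q ^ j * x) = (case b of (j, x) \<Rightarrow> q ^ j * x)"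
      thus "a = b"
        using ab key [of "snd a" "snd b" "fst a" "fst b"] key [of "snd b" "snd a" "fst b" "fst a"]
        by (cases "fst a \<le> fst b") (auto simp: case_prod_unfold prod_eq_iff)
    qed simp
  next
    fix a :: "nat \<times> eis"
    assume "a \<in> UNIV \<times> prime_supported Q"
    then obtain j x where a: "a = (j, x)" "x \<in> prime_supported Q" by auto
    have "p \<in> insert q Q" if p: "prime p" "p dvd q ^ j * x" for p
    proof (cases "p dvd q ^ j")
      case True
      hence "p dvd q" using p prime_dvd_power by blast
      thus ?thesis using p q primes_dvd_imp_eq by blast
    next
      case False
      hence "p dvd x" using p prime_dvd_mult_iff by blast
      thus ?thesis using p a by (auto simp: prime_supported_def)
    qed
    thus "(case a of (j, x) \<Rightarrow> q ^ j * x) \<in> prime_supported (insert q Q)"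
      using a q0 by (auto simp: prime_supported_def)
  next
    fix y assume y: "y \<in> prime_supported (insert q Q)"
    hence y0: "y \<noteq> 0" by (simp add: prime_supported_def)
    have nu: "\<not> q dvd 1" using q(1) not_prime_unit [of q] by auto
    obtain x where x: "y = q ^ multiplicity q y * x" "\<not> q dvd x"
      using multiplicity_decompose' [OF y0 nu] by blast
    have "x \<in> prime_supported Q"
      unfolding prime_supported_def
    proof (intro CollectI conjI allI impI)
      show "x \<noteq> 0" using x y0 by auto
      fix p assume p: "prime p" "p dvd x"
      hence "p dvd y" by (subst x(1)) simp
      hence "p \<in> insert q Q" using y p by (auto simp: prime_supported_def)
      thus "p \<in> Q" using p x by auto
    qed
    thus "\<exists>a\<in>UNIV \<times> prime_supported Q. y = (case a of (j, x) \<Rightarrow> q ^ j * x)"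
      using x(1) by (intro bexI [of _ "(multiplicity q y, x)"]) auto
  qed
qed

section \<open>Units and the trivial action of characters on them\<close>

lemma finite_units_eis: "finite {x::eis. x dvd 1}"
proof (rule finite_subset)
  show "{x::eis. x dvd 1} \<subseteq> (\<lambda>i. omega_eis ^ i) ` {..<6}"
    using is_unit_eis_imp_omega_power by blast
qed simp

definition num_units :: nat where "num_units = card {x::eis. x dvd 1}"

lemma num_units_pos: "num_units > 0"
proof -
  have "(1::eis) \<in> {x. x dvd 1}" by simp
  thus ?thesis unfolding num_units_def using finite_units_eis card_gt_0_iff by blast
qed

text \<open>\<open>omega\<close> is a sixth root of unity, so a character with exponent divisible by
  6 is constant on classes of associates.\<close>

lemma hecke_unit:
  assumes "x dvd (1::eis)" "6 dvd m"
  shows "hecke m s (of_eis x) = 1"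
proof -
  obtain i where "x = omega_eis ^ i" using is_unit_eis_imp_omega_power [OF assms(1)] by blast
  hence "hecke m s (of_eis x) = hecke m s omega ^ i" by (simp add: hecke_power)
  moreover have "hecke m s omega = 1"
  proof -
    have om: "omega = cis (pi / 3)" by (simp add: omega_def cis_conv_exp)
    obtain l where m: "m = 6 * l" using assms(2) by (rule dvdE)
    have "cis (pi / 3) ^ 6 = cis (2 * pi)" by (simp add: Complex.DeMoivre)
    hence "cis (pi / 3) ^ m = 1" by (simp add: m power_mult)
    thus ?thesis by (simp add: hecke_def om)
  qed
  ultimately show ?thesis by simp
qed

lemma eis_norm_prime_ge_2:
  assumes "prime (p::eis)"
  shows "eis_norm p \<ge> 2"
proof -
  have "eis_norm p \<noteq> 0" using assms by auto
  moreover have "eis_norm p \<noteq> 1"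
    using assms is_unit_eis_iff [of p] not_prime_unit [of p] by auto
  ultimately show ?thesis by linarith
qed

lemma norm_hecke_prime_le:
  assumes "prime (p::eis)" "s \<ge> 1"
  shows "norm (hecke m s (of_eis p)) \<le> 1 / 2"
proof -
  have "norm (hecke m s (of_eis p)) = real (eis_norm p) powr (- s)"
    unfolding of_nat_eis_norm by (simp add: norm_hecke power2_powr)
  also have "\<dots> \<le> real (eis_norm p) powr (- 1)"
    using eis_norm_prime_ge_2 [OF assms(1)] assms(2) by (intro powr_mono) auto
  also have "\<dots> \<le> 1 / 2"
    using eis_norm_prime_ge_2 [OF assms(1)] by (simp add: powr_minus field_simps)
  finally show ?thesis .
qed

text \<open>Induction on \<open>Q\<close>: the units give \<open>num_units\<close>, and every
  further prime contributes a geometric series as a factor.\<close>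

lemma euler_product_finite:
  assumes s: "s > 1" and m: "6 dvd m" and "finite Q" "Q \<subseteq> {p. prime p}"
  shows "((\<lambda>x. hecke m s (of_eis x)) has_sum
          (of_nat num_units * (\<Prod>p\<in>Q. 1 / (1 - hecke m s (of_eis p))))) (prime_supported Q)"
  using assms(3,4)
proof (induction Q rule: finite_induct)
  case empty
  have "((\<lambda>x::eis. 1 :: complex) has_sum of_nat num_units) {x. x dvd 1}"
    by (rule has_sum_finiteI) (simp_all add: num_units_def finite_units_eis)
  hence "((\<lambda>x. hecke m s (of_eis x)) has_sum of_nat num_units) {x. x dvd 1}"
    by (rule has_sum_cong [THEN iffD1, rotated]) (simp add: hecke_unit m)
  thus ?case by (simp add: prime_supported_empty)
next
  case (insert q Q)
  define h where "h x = hecke m s (of_eis x)" for x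
  define T where "T = of_nat num_units * (\<Prod>p\<in>Q. 1 / (1 - h p))"
  have q: "prime q" and Q: "Q \<subseteq> {p. prime p}" using insert by auto
  have IH: "(h has_sum T) (prime_supported Q)"
    using insert.IH [OF Q] by (simp only: T_def h_def [abs_def])
  note bij = bij_betw_prime_supported_insert [OF Q q insert.hyps(2)]
  have hq: "norm (h q) < 1" using norm_hecke_prime_le [OF q, of s m] s by (simp add: h_def)
  have h_eq: "h (q ^ j * x) = h q ^ j * h x" for j x by (simp add: h_def hecke_mult hecke_power)
  have "h summable_on (prime_supported (insert q Q))"
    unfolding h_def by (rule hecke_summable [OF s])
  hence summ: "(\<lambda>(j, x). h q ^ j * h x) summable_on (UNIV \<times> prime_supported Q)"
    using summable_on_reindex_bij_betw [OF bij, of h] by (simp add: case_prod_unfold h_eq)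
  have geo: "((\<lambda>j. h q ^ j) has_sum (1 / (1 - h q))) UNIV"
    by (rule norm_summable_imp_has_sum)
       (use hq in \<open>auto simp: norm_power intro: geometric_sums\<close>)
  have "((\<lambda>(j, x). h q ^ j * h x) has_sum (1 / (1 - h q) * T)) (UNIV \<times> prime_supported Q)"
  proof (rule has_sum_SigmaI [OF _ _ summ])
    show "((\<lambda>x. case (j, x) of (j, x) \<Rightarrow> h q ^ j * h x) has_sum (h q ^ j * T)) (prime_supported Q)" for j
      using has_sum_cmult_right [OF IH] by simp
    show "((\<lambda>j. h q ^ j * T) has_sum (1 / (1 - h q) * T)) UNIV"
      by (rule has_sum_cmult_left [OF geo])
  qed
  hence "(h has_sum (1 / (1 - h q) * T)) (prime_supported (insert q Q))"
    using has_sum_reindex_bij_betw [OF bij, of h] by (simp add: case_prod_unfold h_eq)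
  moreover have "of_nat num_units * (\<Prod>p\<in>insert q Q. 1 / (1 - h p)) = 1 / (1 - h q) * T"
    using insert.hyps by (simp add: T_def)
  ultimately show ?case by (simp only: h_def [abs_def])
qed

text \<open>A finite set \<open>F\<close> carries all but \<open>e\<close> of the absolute mass.
  Once \<open>Q\<close> contains the prime divisors of its nonzero elements, the elements missing
  from the finite product lie in the remaining mass.\<close>

lemma euler_product_tendsto:
  assumes s: "s > 1" and m: "6 dvd m"
  shows "((\<lambda>Q. of_nat num_units * (\<Prod>p\<in>Q. 1 / (1 - hecke m s (of_eis p)))) \<longlongrightarrow>
          (\<Sum>\<^sub>\<infinity>x. hecke m s (of_eis x))) (finite_subsets_at_top {p. prime p})"
proof (rule tendstoI)
  fix e :: real assume e: "e > 0"
  define h where "h x = hecke m s (of_eis x)" for x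
  define T where "T = (\<Sum>\<^sub>\<infinity>x. norm (h x))"
  have abs: "(\<lambda>x. norm (h x)) summable_on A" for A
    unfolding h_def by (rule hecke_abs_summable [OF s])
  have summ: "h summable_on A" for A unfolding h_def by (rule hecke_summable [OF s])
  obtain F where F: "finite F" "dist (\<Sum>x\<in>F. norm (h x)) T < e"
  proof -
    have "\<exists>F. finite F \<and> F \<subseteq> UNIV \<and> dist (\<Sum>x\<in>F. norm (h x)) T \<le> e / 2"
      unfolding T_def using e by (intro infsum_finite_approximation abs) auto
    thus ?thesis using that e by fastforce
  qed
  \<comment> \<open>The element 0 is left out, having every prime as divisor; \<open>hecke\<close>
    vanishes there.\<close>
  define Q0 where "Q0 = (\<Union>x\<in>F - {0}. {p. prime p \<and> p dvd x})"
  have "finite Q0" unfolding Q0_def using F(1) by (auto intro: finite_prime_divisors)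
  moreover have "Q0 \<subseteq> {p. prime p}" by (auto simp: Q0_def)
  moreover have "dist (of_nat num_units * (\<Prod>p\<in>Q. 1 / (1 - h p))) (infsum h UNIV) < e"
    if Q: "finite Q" "Q0 \<subseteq> Q" "Q \<subseteq> {p. prime p}" for Q
  proof -
    define A where "A = prime_supported Q"
    have "(h has_sum (of_nat num_units * (\<Prod>p\<in>Q. 1 / (1 - h p)))) A"
      unfolding A_def using euler_product_finite [OF s m Q(1,3)] by (simp only: h_def [abs_def])
    hence prod_eq: "of_nat num_units * (\<Prod>p\<in>Q. 1 / (1 - h p)) = infsum h A"
      by (simp add: infsumI)
    have "infsum h UNIV = infsum h A + infsum h (- A)"
      using infsum_Un_disjoint [of h A "- A"] summ by simp
    hence "dist (infsum h A) (infsum h UNIV) = norm (infsum h (- A))"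
      by (simp add: dist_norm)
    also have "\<dots> \<le> (\<Sum>\<^sub>\<infinity>x\<in>- A. norm (h x))" by (rule norm_infsum_bound [OF abs])
    also have "\<dots> = T - (\<Sum>\<^sub>\<infinity>x\<in>A. norm (h x))"
      unfolding T_def using infsum_Un_disjoint [of "\<lambda>x. norm (h x)" A "- A"] abs by simp
    also have "\<dots> \<le> T - (\<Sum>x\<in>F - {0}. norm (h x))"
    proof -
      have "F - {0} \<subseteq> A" using Q(2) by (auto simp: A_def prime_supported_def Q0_def)
      hence "(\<Sum>x\<in>F - {0}. norm (h x)) \<le> (\<Sum>\<^sub>\<infinity>x\<in>A. norm (h x))"
        using F(1) by (intro finite_sum_le_infsum abs) auto
      thus ?thesis by simp
    qed
    also have "(\<Sum>x\<in>F - {0}. norm (h x)) = (\<Sum>x\<in>F. norm (h x))"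
      using F(1) by (intro sum.mono_neutral_left) (auto simp: h_def)
    also have "T - (\<Sum>x\<in>F. norm (h x)) < e" using F(2) by (simp add: dist_real_def)
    finally show ?thesis by (simp only: prod_eq)
  qed
  ultimately show "eventually (\<lambda>Q. dist (of_nat num_units * (\<Prod>p\<in>Q. 1 / (1 - hecke m s (of_eis p))))
      (\<Sum>\<^sub>\<infinity>x. hecke m s (of_eis x)) < e) (finite_subsets_at_top {p. prime p})"
    unfolding eventually_finite_subsets_at_top h_def by blast
qed

text \<open>A bound, uniform in \<open>s \<ge> 1\<close>, for the second-order terms that arise when
  Euler products are compared with exponentials of prime sums.\<close>

definition fourth_power_sum :: real where
  "fourth_power_sum = (\<Sum>\<^sub>\<infinity>x. cmod (of_eis x) powr (- 4))"

lemma sum_hecke_prime_square_le: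
  assumes "s \<ge> 1" "finite Q" "Q \<subseteq> {p. prime p}"
  shows "(\<Sum>p\<in>Q. (norm (hecke m s (of_eis p)))\<^sup>2) \<le> fourth_power_sum"
proof -
  have "(\<Sum>p\<in>Q. (norm (hecke m s (of_eis p)))\<^sup>2) \<le> (\<Sum>p\<in>Q. cmod (of_eis p) powr (- 4))"
  proof (rule sum_mono)
    fix p assume "p \<in> Q"
    hence "p \<noteq> 0" using assms(3) by auto
    hence p1: "cmod (of_eis p) \<ge> 1" by (rule cmod_of_eis_ge_1)
    have "(norm (hecke m s (of_eis p)))\<^sup>2 = cmod (of_eis p) powr (- 4 * s)"
      unfolding norm_hecke by (simp add: power2_eq_square flip: powr_add)
    also have "\<dots> \<le> cmod (of_eis p) powr (- 4)" using p1 assms(1) by (intro powr_mono) auto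
    finally show "(norm (hecke m s (of_eis p)))\<^sup>2 \<le> cmod (of_eis p) powr (- 4)" .
  qed
  also have "\<dots> \<le> fourth_power_sum" unfolding fourth_power_sum_def
    by (rule finite_sum_le_infsum) (use assms summable_on_cmod_of_eis_powr in auto)
  finally show ?thesis .
qed

text \<open>Works without a complex logarithm: the squared left side has the form
  \<open>1 + x\<close>, which is at most \<open>exp x\<close>.\<close>

lemma norm_one_minus_le_exp:
  "norm (1 - z) \<le> exp ((norm z)\<^sup>2 - Re z)" for z :: complex
proof -
  have "(norm (1 - z))\<^sup>2 = 1 + ((norm z)\<^sup>2 - 2 * Re z)"
    unfolding cmod_power2 by (simp add: power2_eq_square algebra_simps)
  also have "\<dots> \<le> exp ((norm z)\<^sup>2 - 2 * Re z)" by (rule exp_ge_add_one_self)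
  also have "\<dots> \<le> exp (2 * ((norm z)\<^sup>2 - Re z))" by simp
  also have "\<dots> = (exp ((norm z)\<^sup>2 - Re z))\<^sup>2" by (rule exp_double)
  finally show ?thesis by (rule power2_le_imp_le) simp
qed

text \<open>Each Euler factor has modulus at least
  \<open>exp (Re (h p) - (norm (h p))\<^sup>2)\<close>, and the squares sum to at most
  \<open>fourth_power_sum\<close>; then \<open>Q\<close> tends to the set of all primes.\<close>

lemma prime_sum_le_log_lattice_sum:
  assumes s: "s > 1" and m: "6 dvd m"
  shows "real num_units * exp ((\<Sum>\<^sub>\<infinity>p\<in>{p. prime p}. Re (hecke m s (of_eis p))) - fourth_power_sum)
         \<le> norm (\<Sum>\<^sub>\<infinity>x. hecke m s (of_eis x))"
proof (rule tendsto_le)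
  define h where "h x = hecke m s (of_eis x)" for x
  show "finite_subsets_at_top {p::eis. prime p} \<noteq> bot" by simp
  show "((\<lambda>Q. norm (of_nat num_units * (\<Prod>p\<in>Q. 1 / (1 - hecke m s (of_eis p))))) \<longlongrightarrow>
      norm (\<Sum>\<^sub>\<infinity>x. hecke m s (of_eis x))) (finite_subsets_at_top {p. prime p})"
    by (intro tendsto_norm euler_product_tendsto s m)
  have "(\<lambda>p. Re (h p)) summable_on {p. prime p}"
    unfolding h_def by (intro summable_on_Re hecke_summable s)
  hence "((\<lambda>Q. \<Sum>p\<in>Q. Re (h p)) \<longlongrightarrow> (\<Sum>\<^sub>\<infinity>p\<in>{p. prime p}. Re (h p))) (finite_subsets_at_top {p. prime p})"
    by (rule infsum_tendsto)
  thus "((\<lambda>Q. real num_units * exp ((\<Sum>p\<in>Q. Re (h p)) - fourth_power_sum)) \<longlongrightarrow>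
      real num_units * exp ((\<Sum>\<^sub>\<infinity>p\<in>{p. prime p}. Re (hecke m s (of_eis p))) - fourth_power_sum))
      (finite_subsets_at_top {p. prime p})"
    unfolding h_def by (intro tendsto_intros)
  show "eventually (\<lambda>Q. real num_units * exp ((\<Sum>p\<in>Q. Re (h p)) - fourth_power_sum) \<le>
      norm (of_nat num_units * (\<Prod>p\<in>Q. 1 / (1 - hecke m s (of_eis p))))) (finite_subsets_at_top {p. prime p})"
  proof (rule eventually_finite_subsets_at_top_weakI)
    fix Q :: "eis set" assume Q: "finite Q" "Q \<subseteq> {p. prime p}"
    have "exp ((\<Sum>p\<in>Q. Re (h p)) - fourth_power_sum) \<le> exp ((\<Sum>p\<in>Q. Re (h p)) - (\<Sum>p\<in>Q. (norm (h p))\<^sup>2))"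
      using sum_hecke_prime_square_le [OF _ Q, of s m] s by (simp add: h_def)
    also have "\<dots> = (\<Prod>p\<in>Q. exp (Re (h p) - (norm (h p))\<^sup>2))"
      unfolding sum_subtractf [symmetric] by (rule exp_sum [OF Q(1)])
    also have "\<dots> \<le> (\<Prod>p\<in>Q. norm (1 / (1 - h p)))"
    proof (rule prod_mono, safe)
      fix p assume "p \<in> Q"
      hence "norm (h p) \<le> 1 / 2" unfolding h_def using Q s by (intro norm_hecke_prime_le) auto
      hence "h p \<noteq> 1" by auto
      hence pos: "norm (1 - h p) > 0" by simp
      have "exp (Re (h p) - (norm (h p))\<^sup>2) = 1 / exp ((norm (h p))\<^sup>2 - Re (h p))"
        by (simp add: exp_diff)
      also have "\<dots> \<le> 1 / norm (1 - h p)"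
        using pos norm_one_minus_le_exp by (intro divide_left_mono mult_pos_pos) auto
      finally show "exp (Re (h p) - (norm (h p))\<^sup>2) \<le> norm (1 / (1 - h p))" by (simp add: norm_divide)
    qed simp
    also have "\<dots> = norm (\<Prod>p\<in>Q. 1 / (1 - h p))" by (simp add: prod_norm)
    finally show "real num_units * exp ((\<Sum>p\<in>Q. Re (h p)) - fourth_power_sum) \<le>
        norm (of_nat num_units * (\<Prod>p\<in>Q. 1 / (1 - hecke m s (of_eis p))))"
      unfolding norm_mult norm_of_nat h_def by (rule mult_left_mono) simp
  qed
qed

text \<open>The reverse comparison for the trivial character. With \<open>Q\<close> the prime
  divisors of elements of \<open>F\<close>, the finite Euler product already dominates the sum over
  \<open>F\<close>; its factors are estimated by \<open>ln (1 - w) \<ge> - w - 2 * w\<^sup>2\<close>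
  for \<open>w \<le> 1 / 2\<close>.\<close>

lemma finite_lattice_sum_le_prime_sum:
  assumes s: "s > 1" and F: "finite F" "0 \<notin> F"
  shows "(\<Sum>x\<in>F. cmod (of_eis x) powr (- 2 * s)) \<le>
    real num_units * exp ((\<Sum>\<^sub>\<infinity>p\<in>{p. prime p}. cmod (of_eis p) powr (- 2 * s)) + 2 * fourth_power_sum)"
proof -
  define w where "w x = cmod (of_eis x) powr (- 2 * s)" for x
  have h_eq: "hecke 0 s (of_eis x) = of_real (w x)" for x by (simp add: hecke_def w_def)
  have w_summable: "w summable_on A" for A
    using hecke_abs_summable [OF s, of 0 A] by (simp add: norm_hecke w_def [abs_def])
  have w_nonneg: "w x \<ge> 0" for x by (simp add: w_def)
  define Q where "Q = (\<Union>x\<in>F. {p. prime p \<and> p dvd x})"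
  have "finite {p. prime p \<and> p dvd x}" if "x \<in> F" for x
    using that F(2) by (intro finite_prime_divisors) auto
  hence Q: "finite Q" "Q \<subseteq> {p. prime p}" unfolding Q_def using F(1) by auto
  have FA: "F \<subseteq> prime_supported Q" using F(2) by (auto simp: Q_def prime_supported_def)
  have "((\<lambda>x. of_real (w x)) has_sum (complex_of_real (real num_units * (\<Prod>p\<in>Q. 1 / (1 - w p)))))
      (prime_supported Q)"
    using euler_product_finite [OF s _ Q, of 0] by (simp add: h_eq)
  hence "(w has_sum (real num_units * (\<Prod>p\<in>Q. 1 / (1 - w p)))) (prime_supported Q)"
    by (simp only: has_sum_of_real_iff)
  hence "(\<Sum>x\<in>F. w x) \<le> real num_units * (\<Prod>p\<in>Q. 1 / (1 - w p))"
    by (rule finite_sum_le_has_sum) (use F FA w_nonneg in auto)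
  also have "\<dots> \<le> real num_units * exp ((\<Sum>\<^sub>\<infinity>p\<in>{p. prime p}. w p) + 2 * fourth_power_sum)"
  proof (rule mult_left_mono)
    have "(\<Prod>p\<in>Q. 1 / (1 - w p)) \<le> (\<Prod>p\<in>Q. exp (w p + 2 * (w p)\<^sup>2))"
    proof (rule prod_mono, safe)
      fix p assume "p \<in> Q"
      hence "norm (hecke 0 s (of_eis p)) \<le> 1 / 2" using Q s by (intro norm_hecke_prime_le) auto
      hence w2: "w p \<le> 1 / 2" by (simp add: h_eq w_nonneg)
      have "- w p - 2 * (w p)\<^sup>2 \<le> ln (1 - w p)"
        by (rule ln_one_minus_pos_lower_bound [OF w_nonneg w2])
      hence "exp (- (w p + 2 * (w p)\<^sup>2)) \<le> 1 - w p" using w2 by (simp add: ln_ge_iff)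
      hence "1 / (1 - w p) \<le> 1 / exp (- (w p + 2 * (w p)\<^sup>2))"
        using w2 by (intro divide_left_mono mult_pos_pos) auto
      also have "\<dots> = exp (w p + 2 * (w p)\<^sup>2)" by (simp only: exp_minus inverse_eq_divide) simp
      finally show "1 / (1 - w p) \<le> exp (w p + 2 * (w p)\<^sup>2)" .
      show "0 \<le> 1 / (1 - w p)" using w2 by simp
    qed
    also have "\<dots> = exp ((\<Sum>p\<in>Q. w p) + 2 * (\<Sum>p\<in>Q. (w p)\<^sup>2))"
      using Q(1) by (simp add: exp_sum [symmetric] sum.distrib sum_distrib_left)
    also have "\<dots> \<le> exp ((\<Sum>\<^sub>\<infinity>p\<in>{p. prime p}. w p) + 2 * fourth_power_sum)"
    proof -
      have "(\<Sum>p\<in>Q. w p) \<le> (\<Sum>\<^sub>\<infinity>p\<in>{p. prime p}. w p)"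
        using Q w_nonneg by (intro finite_sum_le_infsum w_summable) auto
      moreover have "(\<Sum>p\<in>Q. (w p)\<^sup>2) \<le> fourth_power_sum"
        using sum_hecke_prime_square_le [OF _ Q, of s 0] s by (simp add: h_eq)
      ultimately show ?thesis by simp
    qed
    finally show "(\<Prod>p\<in>Q. 1 / (1 - w p)) \<le> exp ((\<Sum>\<^sub>\<infinity>p\<in>{p. prime p}. w p) + 2 * fourth_power_sum)" .
  qed simp
  finally show ?thesis by (simp only: w_def [abs_def])
qed

text \<open>Bounded prime sums would bound every finite lattice sum for \<open>s\<close> in (1, 2)
  by one constant, hence by continuity also at \<open>s = 1\<close>, where finite sums are
  arbitrarily large.\<close>

lemma prime_mass_unbounded:
  "\<not> (\<exists>B. \<forall>s\<in>{1<..2}. (\<Sum>\<^sub>\<infinity>p\<in>{p. prime p}. cmod (of_eis p) powr (- 2 * s)) \<le> B)"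
proof
  assume "\<exists>B. \<forall>s\<in>{1<..2}. (\<Sum>\<^sub>\<infinity>p\<in>{p. prime p}. cmod (of_eis p) powr (- 2 * s)) \<le> B"
  then obtain B where "\<forall>s\<in>{1<..2}. (\<Sum>\<^sub>\<infinity>p\<in>{p. prime p}. cmod (of_eis p) powr (- 2 * s)) \<le> B" ..
  hence B: "(\<Sum>\<^sub>\<infinity>p\<in>{p. prime p}. cmod (of_eis p) powr (- 2 * s)) \<le> B" if "1 < s" "s \<le> 2" for s
    using that by auto
  define B' where "B' = real num_units * exp (B + 2 * fourth_power_sum)"
  obtain F where F: "finite F" "0 \<notin> F" "(\<Sum>x\<in>F. cmod (of_eis x) powr (- 2)) \<ge> B' + 1"
    using lattice_inverse_square_unbounded by blast
  have "((\<lambda>s. \<Sum>x\<in>F. cmod (of_eis x) powr (- 2 * s)) \<longlongrightarrow> (\<Sum>x\<in>F. cmod (of_eis x) powr (- 2 * 1))) (at_right 1)"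
    using F(2) by (intro tendsto_sum tendsto_powr tendsto_intros) auto
  moreover have "eventually (\<lambda>s. (\<Sum>x\<in>F. cmod (of_eis x) powr (- 2 * s)) \<le> B') (at_right 1)"
  proof -
    have "eventually (\<lambda>s::real. s \<in> {1<..<2}) (at_right 1)" by (rule eventually_at_right_real) simp
    thus ?thesis
    proof (rule eventually_mono)
      fix s :: real assume s: "s \<in> {1<..<2}"
      have "(\<Sum>x\<in>F. cmod (of_eis x) powr (- 2 * s)) \<le>
        real num_units * exp ((\<Sum>\<^sub>\<infinity>p\<in>{p. prime p}. cmod (of_eis p) powr (- 2 * s)) + 2 * fourth_power_sum)"
        using s by (intro finite_lattice_sum_le_prime_sum F) auto
      also have "\<dots> \<le> B'" unfolding B'_def using B [of s] s by (intro mult_left_mono) auto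
      finally show "(\<Sum>x\<in>F. cmod (of_eis x) powr (- 2 * s)) \<le> B'" .
    qed
  qed
  ultimately have "(\<Sum>x\<in>F. cmod (of_eis x) powr (- 2 * 1)) \<le> B'"
    by (rule tendsto_upperbound) simp
  thus False using F(3) by simp
qed

subsection \<open>Split primes near the axes\<close>

lemma cnj_eis_of: "cnj_eis (eis_of (a, b)) = eis_of (a + b, - b)"
  by (simp add: of_eis_eis_of cnj_omega algebra_simps flip: of_eis_eq_iff)

lemma eis_of_mult_omega: "eis_of (a, b) * omega_eis = eis_of (- b, a + b)"
proof -
  have "of_eis (eis_of (a, b) * omega_eis) = of_int a * omega + of_int b * (omega * omega)"
    by (simp add: of_eis_eis_of algebra_simps)
  also have "\<dots> = of_eis (eis_of (- b, a + b))"
    by (simp add: of_eis_eis_of omega_square algebra_simps)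
  finally show ?thesis by (simp only: of_eis_eq_iff)
qed

lemma eis_of_mult_omega_power_Suc:
  "eis_of (a, b) * omega_eis ^ Suc i = eis_of (- b, a + b) * omega_eis ^ i"
  by (simp add: eis_of_mult_omega flip: mult.assoc)

lemma eis_norm_cnj: "eis_norm (cnj_eis x) = eis_norm x"
  by (simp add: eis_norm_def)

text \<open>The conjugate of \<open>x\<close> is then a unit times \<open>x\<close>, which forces
  the argument of a nonzero \<open>x\<close> to be a multiple of pi / 6. The six listed elements
  span the six lines in these directions.\<close>

lemma dvd_cnj_eis_cases:
  assumes "x dvd cnj_eis x"
  shows "\<exists>\<gamma>\<in>{1, omega_eis, 1 - omega_eis, 1 + omega_eis, 1 - 2 * omega_eis, 2 - omega_eis}.
           \<exists>t. x = of_int t * \<gamma>"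
proof (cases "x = 0")
  case True
  thus ?thesis by (intro bexI [of _ 1] exI [of _ 0]) auto
next
  case False
  obtain u where u: "cnj_eis x = x * u" using assms by (rule dvdE)
  have "eis_norm x * eis_norm u = eis_norm x" using u by (metis eis_norm_cnj eis_norm_mult)
  hence "u dvd 1" using False by (simp add: is_unit_eis_iff)
  then obtain i where i: "i < 6" "u = omega_eis ^ i" using is_unit_eis_imp_omega_power by blast
  obtain a b where x: "x = eis_of (a, b)" by (rule eis_of_cases)
  have inj: "eis_of p = eis_of q \<longleftrightarrow> p = q" for p q using bij_eis_of by (simp add: bij_def inj_eq)
  have "i \<in> {0, 1, 2, 3, 4, 5}" using i by auto
  \<comment> \<open>The conjugate has coordinates \<open>(a + b, - b)\<close>; comparing it with
    each rotation of \<open>(a, b)\<close> gives one linear equation per unit.\<close>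
  hence "b = 0 \<or> a = 0 \<or> b = - a \<or> a = b \<or> b = - 2 * a \<or> a = - 2 * b"
    using u unfolding x i cnj_eis_of
    by (auto simp: eis_of_mult_omega_power_Suc eis_of_mult_omega numeral_eq_Suc inj simp del: power_Suc)
  moreover have "eis_of (a, 0) = of_int a * 1" "eis_of (0, b) = of_int b * omega_eis"
    "eis_of (a, - a) = of_int a * (1 - omega_eis)" "eis_of (a, a) = of_int a * (1 + omega_eis)"
    "eis_of (a, - 2 * a) = of_int a * (1 - 2 * omega_eis)"
    "eis_of (- 2 * b, b) = of_int (- b) * (2 - omega_eis)"
    by (simp_all add: eis_of_def algebra_simps)
  ultimately show ?thesis unfolding x by (elim disjE) (simp only:, blast)+
qed

text \<open>On each of the six lines the sum is dominated by one over inverse squares of integers,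
  so self-conjugate primes have bounded mass even at \<open>s = 1\<close>.\<close>

lemma summable_on_self_conjugate:
  "(\<lambda>x. cmod (of_eis x) powr (- 2)) summable_on {x. x dvd cnj_eis x}"
proof -
  have ray: "(\<lambda>x. cmod (of_eis x) powr (- 2)) summable_on range (\<lambda>t. of_int t * \<gamma>)"
    if "\<gamma> \<noteq> 0" for \<gamma> :: eis
  proof -
    have inj: "inj (\<lambda>t. of_int t * \<gamma>)"
    proof (rule injI)
      fix t t' assume "of_int t * \<gamma> = of_int t' * \<gamma>"
      hence "of_eis (of_int t) = of_eis (of_int t')" using that by simp
      thus "t = t'" by (simp only: of_eis_of_int of_int_eq_iff)
    qed
    have "(\<lambda>t::int. (1 + \<bar>real_of_int t\<bar>) powr (- 2) * 4) summable_on UNIV"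
      by (intro summable_on_cmult_left summable_on_int_powr) simp
    hence "(\<lambda>t. cmod (of_eis (of_int t * \<gamma>)) powr (- 2)) summable_on UNIV"
    proof (rule summable_on_comparison_test)
      fix t :: int
      show "cmod (of_eis (of_int t * \<gamma>)) powr (- 2) \<le> (1 + \<bar>real_of_int t\<bar>) powr (- 2) * 4"
      proof (cases "t = 0")
        case False
        hence "\<bar>t\<bar> \<ge> 1" by simp
        hence t: "\<bar>real_of_int t\<bar> \<ge> 1" by linarith
        have "\<bar>real_of_int t\<bar> * 1 \<le> \<bar>real_of_int t\<bar> * cmod (of_eis \<gamma>)"
          using cmod_of_eis_ge_1 [OF that] by (intro mult_left_mono) auto
        hence le: "(1 + \<bar>real_of_int t\<bar>) / 2 \<le> cmod (of_eis (of_int t * \<gamma>))"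
          using t by (simp add: norm_mult)
        have "cmod (of_eis (of_int t * \<gamma>)) powr (- 2) \<le> ((1 + \<bar>real_of_int t\<bar>) / 2) powr (- 2)"
          using le by (intro powr_mono2') auto
        also have "\<dots> = (1 + \<bar>real_of_int t\<bar>) powr (- 2) * 4"
          by (simp add: powr_divide powr_minus powr_numeral field_simps)
        finally show ?thesis .
      qed simp
    qed simp
    thus ?thesis using inj by (simp add: summable_on_reindex o_def)
  qed
  define \<Gamma> where "\<Gamma> = {1, omega_eis, 1 - omega_eis, 1 + omega_eis, 1 - 2 * omega_eis, 2 - omega_eis}"
  have "\<gamma> \<noteq> 0" if "\<gamma> \<in> \<Gamma>" for \<gamma>
  proof -
    have "of_eis 2 = 2" using of_eis_of_nat [of 2] by simp
    hence "Re (of_eis \<gamma>) \<noteq> 0 \<or> Im (of_eis \<gamma>) \<noteq> 0"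
      using that unfolding \<Gamma>_def by (auto simp: omega_eq)
    thus ?thesis by auto
  qed
  hence rays: "(\<lambda>x. cmod (of_eis x) powr (- 2)) summable_on range (\<lambda>t. of_int t * \<gamma>)" if "\<gamma> \<in> \<Gamma>" for \<gamma>
    using ray that by blast
  have "(\<lambda>x. cmod (of_eis x) powr (- 2)) summable_on (\<Union>\<gamma>\<in>G. range (\<lambda>t. of_int t * \<gamma>))"
    if "finite G" "G \<subseteq> \<Gamma>" for G
    using that
  proof (induction G rule: finite_induct)
    case (insert \<gamma> G)
    thus ?case unfolding UN_insert by (intro summable_on_union rays) simp_all
  qed simp
  from this [of \<Gamma>] have "(\<lambda>x. cmod (of_eis x) powr (- 2)) summable_on (\<Union>\<gamma>\<in>\<Gamma>. range (\<lambda>t. of_int t * \<gamma>))"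
    by (simp add: \<Gamma>_def)
  thus ?thesis
  proof (rule summable_on_subset_banach, intro subsetI)
    fix x assume "x \<in> {x. x dvd cnj_eis x}"
    hence "\<exists>\<gamma>\<in>\<Gamma>. \<exists>t. x = of_int t * \<gamma>" unfolding \<Gamma>_def by (intro dvd_cnj_eis_cases) simp
    then obtain \<gamma> t where "\<gamma> \<in> \<Gamma>" "x = of_int t * \<gamma>" by (elim bexE exE)
    thus "x \<in> (\<Union>\<gamma>\<in>\<Gamma>. range (\<lambda>t. of_int t * \<gamma>))" by (intro UN_I [of \<gamma>] range_eqI)
  qed
qed

lemma exists_split_prime_near_axis:
  assumes "\<delta> > 0"
  shows "\<exists>p::eis. prime p \<and> \<not> p dvd cnj_eis p \<and> norm (sgn (of_eis p) ^ 12 - 1) < \<delta>"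
proof (rule ccontr)
  assume neg: "\<not> ?thesis"
  define w where "w s p = cmod (of_eis p) powr (- 2 * s)" for s p
  \<comment> \<open>The exceptional primes: their arguments are multiples of pi / 6, so
    \<open>sgn (of_eis p) ^ 12\<close> equals 1 and they violate the gap, but only with bounded
    mass.\<close>
  define Z where "Z = {p::eis. prime p \<and> p dvd cnj_eis p}"
  have w_summable: "w s summable_on A" if "s > 1" for s A
    using hecke_abs_summable [OF that, of 0 A] by (simp add: norm_hecke w_def [abs_def])
  have Z_summable: "(\<lambda>p. cmod (of_eis p) powr (- 2)) summable_on Z"
    by (rule summable_on_subset_banach [OF summable_on_self_conjugate]) (auto simp: Z_def)
  have "\<exists>B. \<forall>s\<in>{1<..2}. (\<Sum>\<^sub>\<infinity>p\<in>{p. prime p}. w s p) \<le> B"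
  proof (rule mass_bounded_if_gap_at_1 [where Z = Z and \<delta> = "\<delta> / 2" and u = "\<lambda>p. sgn (of_eis p) ^ 12"])
    show "w s summable_on {p. prime p}" if "s \<in> {1<..2}" for s
      using that by (intro w_summable) auto
    show "w s p \<ge> 0" for s p by (simp add: w_def)
    show "norm (sgn (of_eis p) ^ 12) = 1" if "p \<in> {p. prime p}" for p
    proof -
      have "p \<noteq> 0" using that by auto
      thus ?thesis by (simp add: norm_power norm_sgn)
    qed
    show "Z \<subseteq> {p. prime p}" by (auto simp: Z_def)
    show "(\<Sum>\<^sub>\<infinity>p\<in>Z. w s p) \<le> (\<Sum>\<^sub>\<infinity>p\<in>Z. cmod (of_eis p) powr (- 2))" if s: "s \<in> {1<..2}" for s
    proof (rule infsum_mono [OF w_summable Z_summable])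
      fix p assume "p \<in> Z"
      hence "p \<noteq> 0" by (auto simp: Z_def)
      thus "w s p \<le> cmod (of_eis p) powr (- 2)"
        unfolding w_def using s cmod_of_eis_ge_1 by (intro powr_mono) auto
    qed (use s in auto)
    show "\<delta> / 2 > 0" using assms by simp
    show "2 * (\<delta> / 2) \<le> norm (sgn (of_eis p) ^ 12 - 1)" if "p \<in> {p. prime p} - Z" for p
      using neg that by (auto simp: Z_def not_less)
    fix k :: nat assume k: "k \<ge> 1"
    \<comment> \<open>Divisibility by 6 makes the Euler product available; positivity makes the
      lattice sum bounded.\<close>
    have m: "6 dvd 12 * k" "12 * k \<ge> 1" using k by (auto simp: dvd_mult2)
    obtain C where C: "norm (\<Sum>\<^sub>\<infinity>x. hecke (12 * k) s (of_eis x)) \<le> C" if "1 < s" "s \<le> 2" for s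
      using hecke_lattice_sum_bounded [OF m(2)] by metis
    have "(\<Sum>\<^sub>\<infinity>p\<in>{p. prime p}. w s p * Re ((sgn (of_eis p) ^ 12) ^ k)) \<le>
        C / real num_units + fourth_power_sum" if s: "s \<in> {1<..2}" for s
    proof -
      define X where "X = (\<Sum>\<^sub>\<infinity>p\<in>{p. prime p}. Re (hecke (12 * k) s (of_eis p)))"
      have "real num_units * exp (X - fourth_power_sum) \<le> C"
        unfolding X_def
        using prime_sum_le_log_lattice_sum [OF _ m(1), of s] C [of s] s by auto
      hence "exp (X - fourth_power_sum) \<le> C / real num_units"
        using num_units_pos by (simp add: field_simps)
      hence "X \<le> C / real num_units + fourth_power_sum"
        using exp_ge_add_one_self [of "X - fourth_power_sum"] by linarith
      moreover have "X = (\<Sum>\<^sub>\<infinity>p\<in>{p. prime p}. w s p * Re ((sgn (of_eis p) ^ 12) ^ k))"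
        unfolding X_def by (rule infsum_cong) (simp add: hecke_def w_def power_mult)
      ultimately show ?thesis by simp
    qed
    thus "\<exists>C. \<forall>s\<in>{1<..2}. (\<Sum>\<^sub>\<infinity>p\<in>{p. prime p}. w s p * Re ((sgn (of_eis p) ^ 12) ^ k)) \<le> C" by blast
  qed
  thus False using prime_mass_unbounded by (simp add: w_def)
qed

subsection \<open>Lattice points of norm a power of a split prime\<close>

text \<open>One factor \<open>p\<close> is removed at a time: being prime, it divides
  \<open>x\<close> or the cofactor.\<close>

lemma dvd_prime_elem_power_mult:
  fixes p :: "'a :: idom"
  assumes "prime_elem p" "x dvd p ^ a * y"
  shows "\<exists>i\<le>a. \<exists>x'. x = p ^ i * x' \<and> x' dvd y"
  using assms(2)
proof (induction a arbitrary: x)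
  case 0
  thus ?case by auto
next
  case (Suc a)
  have p0: "p \<noteq> 0" using assms(1) by (rule prime_elem_not_zeroI)
  obtain t where t: "p * (p ^ a * y) = x * t" using Suc.prems by (auto simp: mult.assoc elim: dvdE)
  hence "p dvd x * t" by (metis dvd_triv_left)
  then consider "p dvd x" | "p dvd t" using assms(1) prime_elem_dvd_multD by blast
  thus ?case
  proof cases
    case 1
    then obtain x1 where x1: "x = p * x1" by (rule dvdE)
    hence "p ^ a * y = x1 * t" using t p0 by (simp add: mult.assoc)
    hence "x1 dvd p ^ a * y" by simp
    then obtain i x' where "i \<le> a" "x1 = p ^ i * x'" "x' dvd y" using Suc.IH by blast
    thus ?thesis using x1 by (intro exI [of _ "Suc i"]) (auto simp: mult.assoc)
  next
    case 2
    then obtain t1 where t1: "t = p * t1" by (rule dvdE)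
    have "p * (p ^ a * y) = p * (x * t1)" using t t1 by (simp add: mult_ac)
    hence "p ^ a * y = x * t1" using p0 by simp
    hence "x dvd p ^ a * y" by simp
    then obtain i x' where "i \<le> a" "x = p ^ i * x'" "x' dvd y" using Suc.IH by blast
    thus ?thesis by (intro exI [of _ i]) auto
  qed
qed

lemma cnj_eis_dvd_iff: "cnj_eis x dvd cnj_eis y \<longleftrightarrow> x dvd y"
proof -
  have "cnj_eis x dvd cnj_eis y" if "x dvd y" for x y
    using that by (auto elim!: dvdE)
  from this [of x y] this [of "cnj_eis x" "cnj_eis y"] show ?thesis by auto
qed

text \<open>Conjugation is a ring automorphism. The claim is about \<open>prime_elem\<close> because
  the conjugate of a normalized prime may fail to be the chosen representative of its class.\<close>

lemma prime_elem_cnj_eis: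
  assumes "prime_elem p"
  shows "prime_elem (cnj_eis p)"
proof (rule prime_elemI)
  show "cnj_eis p \<noteq> 0" using assms by auto
  have "\<not> p dvd 1" using assms by (rule prime_elem_not_unit)
  thus "\<not> cnj_eis p dvd 1" using cnj_eis_dvd_iff [of p 1] by simp
  fix a b assume "cnj_eis p dvd a * b"
  hence "p dvd cnj_eis a * cnj_eis b" using cnj_eis_dvd_iff [of "cnj_eis p" "a * b"] by simp
  hence "p dvd cnj_eis a \<or> p dvd cnj_eis b" using assms by (rule prime_elem_dvd_multD [rotated])
  thus "cnj_eis p dvd a \<or> cnj_eis p dvd b"
    using cnj_eis_dvd_iff [of p "cnj_eis a"] cnj_eis_dvd_iff [of p "cnj_eis b"] by auto
qed

text \<open>Such an \<open>x\<close> divides \<open>x * cnj_eis x = p ^ m * cnj_eis p ^ m\<close>;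
  stripping powers of \<open>p\<close> and of its conjugate leaves a unit, and the norm forces the
  exponents to add up to \<open>m\<close>.\<close>

lemma eis_norm_eq_prime_power:
  assumes p: "prime p" and x: "eis_norm x = eis_norm p ^ m"
  shows "\<exists>v<6. \<exists>i\<le>m. x = omega_eis ^ v * (p ^ i * cnj_eis p ^ (m - i))"
proof -
  have pe: "prime_elem p" using p by auto
  have "x * cnj_eis x = (p * cnj_eis p) ^ m" by (simp add: mult_cnj_eis x)
  hence "x dvd p ^ m * (cnj_eis p ^ m * 1)" by (metis dvd_triv_left mult.right_neutral power_mult_distrib)
  from dvd_prime_elem_power_mult [OF pe this]
  obtain i x' where i: "x = p ^ i * x'" "x' dvd cnj_eis p ^ m * 1" by blast
  from dvd_prime_elem_power_mult [OF prime_elem_cnj_eis [OF pe] i(2)]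
  obtain j u where j: "x' = cnj_eis p ^ j * u" "u dvd 1" by blast
  obtain v where v: "v < 6" "u = omega_eis ^ v" using is_unit_eis_imp_omega_power [OF j(2)] by blast
  have "eis_norm x = eis_norm p ^ i * (eis_norm p ^ j * 1)"
    using j(2) unfolding i(1) j(1) eis_norm_mult eis_norm_power eis_norm_cnj is_unit_eis_iff by simp
  hence "eis_norm p ^ (i + j) = eis_norm p ^ m" using x by (simp add: power_add)
  hence "i + j = m" using eis_norm_prime_ge_2 [OF p] by (simp add: power_inject_exp)
  hence "i \<le> m" "j = m - i" by auto
  thus ?thesis using v i(1) j(1) by (intro exI [of _ v] conjI exI [of _ i]) (auto simp: mult_ac)
qed

text \<open>The \<open>m + 1\<close> products of powers of \<open>p\<close> and its conjugate are
  distinct: a coincidence would make \<open>p\<close> divide a power of the conjugate, hence the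
  conjugate itself.\<close>

lemma card_eis_norm_eq_prime_power:
  assumes p: "prime p" "\<not> p dvd cnj_eis p"
  shows "card {x. eis_norm x = eis_norm p ^ m} > m"
proof -
  define e where "e i = p ^ i * cnj_eis p ^ (m - i)" for i
  have p0: "p \<noteq> 0" using p by auto
  have aux: False if "i < j" "j \<le> m" "e i = e j" for i j
  proof -
    have "p ^ i * cnj_eis p ^ (m - i) = p ^ i * (p ^ (j - i) * cnj_eis p ^ (m - j))"
      using that by (simp add: e_def flip: power_add mult.assoc)
    hence "cnj_eis p ^ (m - i) = p ^ (j - i) * cnj_eis p ^ (m - j)" using p0 by simp
    moreover have "p dvd p ^ (j - i)" using that by (intro dvd_power) auto
    ultimately have "p dvd cnj_eis p ^ (m - i)" by simp
    thus False using p prime_dvd_power by blast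
  qed
  have inj: "inj_on e {..m}"
    by (rule linorder_inj_onI) (use aux in auto)
  have "e ` {..m} \<subseteq> {x. eis_norm x = eis_norm p ^ m}"
  proof safe
    fix i assume "i \<le> m"
    show "eis_norm (e i) = eis_norm p ^ m"
      unfolding e_def eis_norm_mult eis_norm_power eis_norm_cnj using \<open>i \<le> m\<close> by (simp flip: power_add)
  qed
  \<comment> \<open>Finiteness matters, since \<open>card\<close> of an infinite set is 0.\<close>
  moreover have "finite {x. eis_norm x = eis_norm p ^ m}"
  proof (rule finite_subset)
    show "{x. eis_norm x = eis_norm p ^ m} \<subseteq> (\<lambda>(v, i). omega_eis ^ v * e i) ` ({..<6} \<times> {..m})"
      using eis_norm_eq_prime_power [OF p(1)] unfolding e_def by fastforce
  qed simp
  ultimately have "card (e ` {..m}) \<le> card {x. eis_norm x = eis_norm p ^ m}" by (intro card_mono)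
  thus ?thesis using inj by (simp add: card_image)
qed

section \<open>Angles of the lattice points on the chosen circle\<close>

theorem theorem5p7:
  fixes \<epsilon> :: real and k :: nat
  assumes "\<epsilon> > 0"
  shows "\<exists>n::nat.
     card {\<mu> \<in> eisenstein. (cmod \<mu>)^2 = real n} > k \<and>
     (\<forall>\<mu> \<in> eisenstein. (cmod \<mu>)^2 = real n \<longrightarrow>
        (\<exists>\<nu>::nat \<in> {0..5}. \<exists>\<phi>::real. \<bar>\<phi>\<bar> < \<epsilon> \<and>
           \<mu> = of_real (sqrt (real n)) * exp (\<i> * of_real (real \<nu> * pi / 3 + \<phi>))))"
proof -
  \<comment> \<open>The deviation \<eta> will be multiplied by an integer of absolute value at most
    \<open>k\<close>; dividing by \<open>k + 1\<close> also covers \<open>k = 0\<close>.\<close>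
  define \<epsilon>' where "\<epsilon>' = \<epsilon> / (real k + 1)"
  have \<epsilon>': "\<epsilon>' > 0" using assms by (simp add: \<epsilon>'_def)
  have "isCont Arg 1" by (rule continuous_at_Arg) auto
  hence "\<exists>\<delta>>0. \<forall>z. dist z 1 < \<delta> \<longrightarrow> dist (Arg z) (Arg 1) < \<epsilon>'"
    using \<epsilon>' unfolding continuous_at_eps_delta by blast
  then obtain \<delta> where \<delta>: "\<delta> > 0" "\<And>z. norm (z - 1) < \<delta> \<Longrightarrow> \<bar>Arg z\<bar> < \<epsilon>'"
    by (auto simp: dist_norm)
  obtain p :: eis where p: "prime p" "\<not> p dvd cnj_eis p" "norm (sgn (of_eis p) ^ 12 - 1) < \<delta>"
    using exists_split_prime_near_axis [OF \<delta>(1)] by blast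
  have p0: "of_eis p \<noteq> 0" using p by auto
  define r where "r = cmod (of_eis p)"
  define \<theta> where "\<theta> = Arg (of_eis p)"
  define \<eta> where "\<eta> = Arg (sgn (of_eis p) ^ 12)"
  have \<eta>: "\<bar>\<eta>\<bar> < \<epsilon>'" unfolding \<eta>_def by (rule \<delta>(2) [OF p(3)])
  have sgn_p: "sgn (of_eis p) = cis \<theta>" unfolding \<theta>_def using p0 by (simp add: cis_Arg)
  have p_eq: "of_eis p = of_real r * cis \<theta>"
    unfolding r_def sgn_p [symmetric] using p0 by (simp add: sgn_eq)
  have "cis \<eta> = cis (12 * \<theta>)"
  proof -
    have "cis \<eta> = sgn (cis \<theta> ^ 12)" unfolding \<eta>_def sgn_p by (rule cis_Arg) simp
    thus ?thesis by (simp add: Complex.DeMoivre)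
  qed
  hence "sin (12 * \<theta>) = sin \<eta> \<and> cos (12 * \<theta>) = cos \<eta>" by (simp add: complex_eq_iff)
  \<comment> \<open>So \<theta> is \<eta> / 12 plus a multiple of pi / 6.\<close>
  then obtain t :: int where t: "12 * \<theta> = \<eta> + 2 * pi * t" unfolding sin_cos_eq_iff by blast
  \<comment> \<open>With an even total exponent, the exponents of \<open>p\<close> and its conjugate
    differ by an even number \<open>2 * d\<close>, so the multiple of pi / 6 in \<theta> turns into
    a multiple of pi / 3. At the same time there are more than \<open>2 * k\<close> points.\<close>
  define n where "n = eis_norm p ^ (2 * k)"
  have n_iff: "(cmod (of_eis x))\<^sup>2 = real n \<longleftrightarrow> eis_norm x = eis_norm p ^ (2 * k)" for x
    unfolding n_def of_nat_eis_norm [symmetric] by (simp only: of_nat_eq_iff)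
  have sqrt_n: "sqrt (real n) = r ^ (2 * k)"
    by (simp add: n_def of_nat_eis_norm r_def real_sqrt_power)
  have "{\<mu> \<in> eisenstein. (cmod \<mu>)\<^sup>2 = real n} = of_eis ` {x. eis_norm x = eis_norm p ^ (2 * k)}"
  proof (rule set_eqI)
    fix \<mu>
    show "\<mu> \<in> {\<mu> \<in> eisenstein. (cmod \<mu>)\<^sup>2 = real n} \<longleftrightarrow> \<mu> \<in> of_eis ` {x. eis_norm x = eis_norm p ^ (2 * k)}"
      using of_eis Abs_eis_inverse [of \<mu>] n_iff by (auto simp: image_iff) (metis n_iff)
  qed
  hence "card {\<mu> \<in> eisenstein. (cmod \<mu>)\<^sup>2 = real n} = card {x. eis_norm x = eis_norm p ^ (2 * k)}"
    by (simp add: card_image inj_on_def)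
  hence "card {\<mu> \<in> eisenstein. (cmod \<mu>)\<^sup>2 = real n} > k"
    using card_eis_norm_eq_prime_power [OF p(1,2), of "2 * k"] by simp
  moreover have "\<exists>\<nu>::nat \<in> {0..5}. \<exists>\<phi>::real. \<bar>\<phi>\<bar> < \<epsilon> \<and>
      \<mu> = of_real (sqrt (real n)) * exp (\<i> * of_real (real \<nu> * pi / 3 + \<phi>))"
    if \<mu>: "\<mu> \<in> eisenstein" "(cmod \<mu>)\<^sup>2 = real n" for \<mu>
  proof -
    define x where "x = Abs_eis \<mu>"
    have x: "of_eis x = \<mu>" unfolding x_def using \<mu>(1) by (rule Abs_eis_inverse)
    have "eis_norm x = eis_norm p ^ (2 * k)" using \<mu>(2) by (simp add: x flip: n_iff)
    then obtain v i where vi: "i \<le> 2 * k" "x = omega_eis ^ v * (p ^ i * cnj_eis p ^ (2 * k - i))"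
      using eis_norm_eq_prime_power [OF p(1)] by blast
    have om: "omega = cis (pi / 3)" by (simp add: omega_def cis_conv_exp)
    define d where "d = int i - int k"
    have d: "real i - real (2 * k - i) = 2 * of_int d" using vi(1) by (simp add: d_def of_nat_diff)
    have "\<mu> = cis (pi / 3) ^ v * ((of_real r * cis \<theta>) ^ i * (of_real r * cis (- \<theta>)) ^ (2 * k - i))"
      unfolding x [symmetric] vi(2) by (simp add: om p_eq cis_cnj)
    also have "\<dots> = (of_real r ^ i * of_real r ^ (2 * k - i)) *
        (cis (real v * (pi / 3)) * (cis (real i * \<theta>) * cis (real (2 * k - i) * - \<theta>)))"
      by (simp only: power_mult_distrib Complex.DeMoivre mult_ac)
    also have "of_real r ^ i * of_real r ^ (2 * k - i) = complex_of_real (sqrt (real n))"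
      using vi(1) by (simp add: sqrt_n flip: power_add)
    also have "cis (real v * (pi / 3)) * (cis (real i * \<theta>) * cis (real (2 * k - i) * - \<theta>)) =
        cis (real v * (pi / 3) + (real i - real (2 * k - i)) * \<theta>)"
      unfolding cis_mult by (rule arg_cong [of _ _ cis]) (simp add: algebra_simps)
    also have "real v * (pi / 3) + (real i - real (2 * k - i)) * \<theta> =
        of_int (int v + d * t) * pi / 3 + of_int d * \<eta> / 6"
    proof -
      have \<theta>_eq: "\<theta> = (\<eta> + 2 * pi * t) / 12" using t by simp
      show ?thesis unfolding d by (subst \<theta>_eq) (simp add: field_simps)
    qed
    finally have \<mu>_eq: "\<mu> = of_real (sqrt (real n)) *
        cis (of_int (int v + d * t) * pi / 3 + of_int d * \<eta> / 6)" .
    \<comment> \<open>Only \<open>N\<close> modulo 6 matters, six steps of pi / 3 being a full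
      turn.\<close>
    define N where "N = int v + d * t"
    define \<nu> where "\<nu> = nat (N mod 6)"
    have \<nu>: "\<nu> \<in> {0..5}" unfolding \<nu>_def using pos_mod_bound [of 6 N] by auto
    have "int \<nu> = N mod 6" by (simp add: \<nu>_def)
    hence "N = int \<nu> + 6 * (N div 6)" by simp
    hence "real_of_int N = real \<nu> + 6 * of_int (N div 6)"
      by (metis of_int_add of_int_mult of_int_numeral of_int_of_nat_eq)
    hence shift: "of_int N * pi / 3 + of_int d * \<eta> / 6 =
        (real \<nu> * pi / 3 + of_int d * \<eta> / 6) + 2 * pi * of_int (N div 6)"
      by (simp add: field_simps)
    have "cis (of_int N * pi / 3 + of_int d * \<eta> / 6) = cis (real \<nu> * pi / 3 + of_int d * \<eta> / 6)"
      unfolding shift cis_mult [symmetric, of _ "2 * pi * of_int (N div 6)"]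
      by (simp add: cis_multiple_2pi)
    hence "\<mu> = of_real (sqrt (real n)) * exp (\<i> * of_real (real \<nu> * pi / 3 + of_int d * \<eta> / 6))"
      using \<mu>_eq unfolding N_def [symmetric] cis_conv_exp by simp
    moreover have "\<bar>of_int d * \<eta> / 6\<bar> < \<epsilon>"
    proof -
      have "\<bar>d\<bar> \<le> int k" using vi(1) by (auto simp: d_def)
      hence dk: "\<bar>real_of_int d\<bar> \<le> real k" by linarith
      have "\<bar>of_int d * \<eta> / 6\<bar> = \<bar>real_of_int d\<bar> * \<bar>\<eta>\<bar> / 6" by (simp add: abs_mult)
      also have "\<dots> \<le> \<bar>real_of_int d\<bar> * \<bar>\<eta>\<bar>" by simp
      also have "\<dots> \<le> real k * \<epsilon>'" using dk \<eta> by (intro mult_mono) auto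
      also have "\<dots> < \<epsilon>" using assms by (simp add: \<epsilon>'_def field_simps)
      finally show ?thesis .
    qed
    ultimately show ?thesis using \<nu> by blast
  qed
  ultimately show ?thesis by blast
qed

end
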